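(* Let $G$ be a Laman graph, and let $F_\bullet, F_\bullet'$ be two maximal chains of flats on $G$, giving rise to fully excised $\mathbb{F},\mathbb{F}'\in V(\Gamma_G)$, respectively. Then $F_\bullet$ and $F_\bullet'$ form an arboreal pair if and only if $\langle\mathbb{F},\mathbb{F}'\rangle=1$.
   Context: Laman graphs: a Laman graph is a finite simple graph $G$ with $|E(G)|=2|V(G)|-3$ and $|E(G')|\le 2|V(G')|-3$ for every vertex-induced subgraph $G'$ (with at least two vertices). Write $E(G)=[m]=\{1,\dots,m\}$ and $n=|V(G)|$. Multigraphs: all multigraphs are finite and loopless. A multiedge of a multigraph $\mathbb{G}$ is a nonempty set $\mathbf{e}\subseteq E(\mathbb{G})$ consisting of all edges joining two given vertices. A multiedge is isolated if it is the edge set of a connected component. For $F\subseteq[m]$, $\mathbf{1}_F\in\{0,1\}^m$ is its indicator vector. Excision: for a non-isolated multiedge $\mathbf{e}$ joining $v_1,v_2$, the excision $\mathbb{G}\curvearrowright\mathbf{e}$ is the multigraph with vertex set $V(\mathbb{G})\sqcup\{v_{12}\}$ and the same (labelled) edges as $\mathbb{G}$, where edges in $\mathbf{e}$ still join $v_1,v_2$, edges meeting neither $v_1$ nor $v_2$ are unchanged, and every edge joining some $v\notin\{v_1,v_2\}$ to $v_1$ or $v_2$ now joins $v$ to $v_{12}$. $V(\Gamma_G)$ is the set of all multigraphs $G\curvearrowright\mathbf{e}_1\curvearrowright\dots\curvearrowright\mathbf{e}_r$ obtained from $G$ by valid chains of excisions (including $G$ itself; identified up to renaming vertices with edge labels fixed).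 An element is fully excised if it is a disjoint union of multiedges. Flats: a flat of $\mathbb{G}$ is a flat of its graphic matroid (an edge set of a subgraph whose connected components are vertex-induced); it is proper if it is not the whole edge set. A maximal chain of proper flats of $G$ has the form $\emptyset=F_0\subsetneq F_1\subsetneq\dots\subsetneq F_{n-2}$ with $\mathrm{rank}(F_j)=j$; put $F_{n-1}=[m]$. Its reduced flats are the sets $P_j=F_j\setminus F_{j-1}$, $j=1,\dots,n-1$, which partition $[m]$. The chain gives rise to the fully excised graph $\mathbb{F}=G\curvearrowright P_1\curvearrowright P_2\curvearrowright\dots\curvearrowright P_{n-2}$, whose multiedges are $P_1,\dots,P_{n-1}$. Arboreal pairs: for two maximal chains $F_\bullet,F_\bullet'$ with reduced flats $P_1,\dots,P_{n-1}$ and $P_1',\dots,P_{n-1}'$, the intersection graph $I_{F_\bullet,F_\bullet'}$ is the bipartite multigraph with vertex set $\{P_j\}\sqcup\{P_j'\}$ and exactly one edge for each $i\in[m]$, joining the unique $P_j$ containing $i$ to the unique $P_k'$ containing $i$. $F_\bullet$ and $F_\bullet'$ form an arboreal pair if $I_{F_\bullet,F_\bullet'}$ is a tree. Tropicalization: for a connected multigraph $\mathbb{G}'$ and a chain of proper flats $F_\bullet:\emptyset=F_0\subsetneq F_1\subsetneq\dots\subsetneq F_r$ of $\mathbb{G}'$, put $\sigma(F_\bullet)=\sum_{j}\mathbb{R}_{\ge0}\mathbf{1}_{F_j}+\mathbb{R}\mathbf{1}_{E(\mathbb{G}')}\subseteq\mathbb{R}^{E(\mathbb{G}')}$. For connected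 $\mathbb{G}'$, $\mathrm{Trop}(\mathbb{G}')$ is the fan of all $\sigma(F_\bullet)$, with multiplicity $1$ on maximal cones; for general $\mathbb{G}$ with edge set $[m]$, $\mathrm{Trop}(\mathbb{G})\subseteq\mathbb{R}^m$ is the product of the fans of its connected components, with all maximal multiplicities $1$. Galactic pairing: $\langle\mathbb{H},\mathbb{H}'\rangle=\mathrm{Trop}(\mathbb{H})\cdot(-\mathrm{Trop}(\mathbb{H}'))$ for $\mathbb{H},\mathbb{H}'\in V(\Gamma_G)$, defined as $0$ if the stable intersection $\mathrm{Trop}(\mathbb{H})\wedge(-\mathrm{Trop}(\mathbb{H}'))$ is empty, and otherwise as the multiplicity of $\mathrm{Span}(\mathbf{1}_{[m]})$ in it (it is then exactly this line). Here the stable intersection of balanced complexes $\Sigma_1,\Sigma_2$ in $\mathbb{R}^m$ consists of the $\sigma_1\cap\sigma_2$ with $\dim(\sigma_1+\sigma_2)=m$; the multiplicity of a maximal $\sigma_1\cap\sigma_2$ is $\sum\mathrm{mult}(\tau_1)\mathrm{mult}(\tau_2)[\mathbb{Z}^m:N_{1}+N_{2}]$ over maximal $\tau_i\in\Sigma_i$ containing $\sigma_1\cap\sigma_2$ with $\tau_1\cap(\tau_2+\varepsilon u)\ne\emptyset$ for a fixed generic $u$ and all small $\varepsilon>0$, where $N_i$ is the set of lattice points in the linear span parallel to $\tau_i$. *)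

theory Defs
  imports "HOL-Analysis.Analysis" "HOL-Library.Infinite_Typeclass"
begin

section \<open>Multigraphs\<close>

record ('v, 'e) multigraph =
  verts :: "'v set"
  edges :: "'e set"
  ends :: "'e \<Rightarrow> 'v set"

definition wf_multigraph :: "('v, 'e) multigraph \<Rightarrow> bool" where
  "wf_multigraph H \<longleftrightarrow> finite (verts H) \<and> finite (edges H) \<and>
     (\<forall>e\<in>edges H. ends H e \<subseteq> verts H \<and> card (ends H e) = 2)"

definition simple_graph :: "('v, 'e) multigraph \<Rightarrow> bool" where
  "simple_graph H \<longleftrightarrow> wf_multigraph H \<and> inj_on (ends H) (edges H)"

definition induced_subgraph :: "('v, 'e) multigraph \<Rightarrow> 'v set \<Rightarrow> ('v, 'e) multigraph" where
  "induced_subgraph H W = H\<lparr>verts := W, edges := {e \<in> edges H. ends H e \<subseteq> W}\<rparr>"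

definition laman :: "('v, 'e) multigraph \<Rightarrow> bool" where
  "laman G \<longleftrightarrow> simple_graph G \<and>
     int (card (edges G)) = 2 * int (card (verts G)) - 3 \<and>
     (\<forall>W\<subseteq>verts G. 2 \<le> card W \<longrightarrow>
        int (card (edges (induced_subgraph G W))) \<le> 2 * int (card W) - 3)"

definition adj :: "('v, 'e) multigraph \<Rightarrow> ('v \<times> 'v) set" where
  "adj H = {(u, v). \<exists>e\<in>edges H. ends H e = {u, v}}"

definition connected_graph :: "('v, 'e) multigraph \<Rightarrow> bool" where
  "connected_graph H \<longleftrightarrow> verts H \<noteq> {} \<and> (\<forall>u\<in>verts H. \<forall>v\<in>verts H. (u, v) \<in> (adj H)\<^sup>*)"

definition components_of :: "('v, 'e) multigraph \<Rightarrow> ('v, 'e) multigraph set" where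
  "components_of H = (\<lambda>u. induced_subgraph H {v \<in> verts H. (u, v) \<in> (adj H)\<^sup>*}) ` verts H"

text \<open>A cycle of length two consists of two parallel edges.\<close>

definition is_cycle :: "('v, 'e) multigraph \<Rightarrow> 'v list \<Rightarrow> 'e list \<Rightarrow> bool" where
  "is_cycle H vs es \<longleftrightarrow> length vs = length es \<and> 2 \<le> length es \<and> distinct vs \<and> distinct es \<and>
     set es \<subseteq> edges H \<and>
     (\<forall>i<length es. ends H (es ! i) = {vs ! i, vs ! (Suc i mod length es)})"

definition is_tree :: "('v, 'e) multigraph \<Rightarrow> bool" where
  "is_tree H \<longleftrightarrow> connected_graph H \<and> (\<nexists>vs es. is_cycle H vs es)"


section \<open>Multiedges and excision\<close>

definition is_multiedge :: "('v, 'e) multigraph \<Rightarrow> 'e set \<Rightarrow> bool" where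
  "is_multiedge H A \<longleftrightarrow> A \<noteq> {} \<and> (\<exists>u v. u \<noteq> v \<and> A = {e \<in> edges H. ends H e = {u, v}})"

definition is_isolated :: "('v, 'e) multigraph \<Rightarrow> 'e set \<Rightarrow> bool" where
  "is_isolated H A \<longleftrightarrow> (\<exists>C\<in>components_of H. edges C = A)"

text \<open>The set \<open>S\<close> below is \<open>{v\<^sub>1, v\<^sub>2}\<close>.  The new vertex \<open>w\<close> exists because
  the vertex sets are finite and the type of vertices is infinite; since only graphs up to renaming
  of vertices matter, the choice of \<open>w\<close> is irrelevant.\<close>

definition excise :: "('v::infinite, 'e) multigraph \<Rightarrow> 'e set \<Rightarrow> ('v, 'e) multigraph" where
  "excise H A =
     (let w = (SOME w. w \<notin> verts H); S = (\<Union>e\<in>A. ends H e)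
      in H\<lparr>verts := insert w (verts H),
           ends := (\<lambda>e. if e \<in> A \<or> ends H e \<inter> S = {} then ends H e
                        else insert w (ends H e - S))\<rparr>)"

text \<open>\<open>V(\<Gamma>\<^sub>G)\<close>, with one representative for each sequence of excisions.\<close>

inductive_set gamma_vertices :: "('v::infinite, 'e) multigraph \<Rightarrow> ('v, 'e) multigraph set"
  for G where
  base: "G \<in> gamma_vertices G"
| step: "H \<in> gamma_vertices G \<Longrightarrow> is_multiedge H A \<Longrightarrow> \<not> is_isolated H A
         \<Longrightarrow> excise H A \<in> gamma_vertices G"

definition fully_excised :: "('v, 'e) multigraph \<Rightarrow> bool" where
  "fully_excised H \<longleftrightarrow> (\<forall>C\<in>components_of H. is_multiedge H (edges C))"


section \<open>Flats\<close>

text \<open>The subgraph with edge set \<open>F\<close> is taken to be spanning; this is harmless, since a single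
  vertex is a vertex-induced subgraph of a loopless multigraph.\<close>

definition is_flat :: "('v, 'e) multigraph \<Rightarrow> 'e set \<Rightarrow> bool" where
  "is_flat H F \<longleftrightarrow> F \<subseteq> edges H \<and>
     (\<forall>C\<in>components_of (H\<lparr>edges := F\<rparr>). edges C = edges (induced_subgraph H (verts C)))"

definition flat_chain :: "('v, 'e) multigraph \<Rightarrow> 'e set list \<Rightarrow> bool" where
  "flat_chain H Fs \<longleftrightarrow> Fs \<noteq> [] \<and> hd Fs = {} \<and> sorted_wrt (\<subset>) Fs \<and>
     (\<forall>F\<in>set Fs. is_flat H F \<and> F \<noteq> edges H)"

definition maximal_flat_chain :: "('v, 'e) multigraph \<Rightarrow> 'e set list \<Rightarrow> bool" where
  "maximal_flat_chain H Fs \<longleftrightarrow> flat_chain H Fs \<and>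
     (\<forall>Fs'. flat_chain H Fs' \<and> set Fs \<subseteq> set Fs' \<longrightarrow> Fs' = Fs)"

text \<open>For \<open>Fs = [F\<^sub>0, \<dots>, F\<^sub>r]\<close> this is
  \<open>[F\<^sub>1 - F\<^sub>0, \<dots>, F\<^sub>r - F\<^sub>r\<^sub>-\<^sub>1, E - F\<^sub>r]\<close>, where \<open>E\<close> is the set of all edges.\<close>

definition reduced_flats :: "('v, 'e) multigraph \<Rightarrow> 'e set list \<Rightarrow> 'e set list" where
  "reduced_flats H Fs = map2 (\<lambda>F F'. F' - F) Fs (tl Fs @ [edges H])"

definition chain_excision :: "('v::infinite, 'e) multigraph \<Rightarrow> 'e set list \<Rightarrow> ('v, 'e) multigraph"
  where "chain_excision G Fs = foldl excise G (butlast (reduced_flats G Fs))"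

definition intersection_graph ::
    "('v, 'e) multigraph \<Rightarrow> 'e set list \<Rightarrow> 'e set list \<Rightarrow> ('e set + 'e set, 'e) multigraph" where
  "intersection_graph G Fs Fs' =
     \<lparr>verts = Inl ` set (reduced_flats G Fs) \<union> Inr ` set (reduced_flats G Fs'),
      edges = edges G,
      ends = (\<lambda>i. {Inl (THE P. P \<in> set (reduced_flats G Fs) \<and> i \<in> P),
                   Inr (THE P. P \<in> set (reduced_flats G Fs') \<and> i \<in> P)})\<rparr>"

definition arboreal_pair :: "('v, 'e) multigraph \<Rightarrow> 'e set list \<Rightarrow> 'e set list \<Rightarrow> bool" where
  "arboreal_pair G Fs Fs' \<longleftrightarrow> is_tree (intersection_graph G Fs Fs')"


section \<open>Weighted complexes and stable intersection\<close>

text \<open>The multiplicities are only meaningful on the cells that are maximal under inclusion.\<close>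

record 'm weighted_complex =
  cells :: "(real^'m) set set"
  mult :: "(real^'m) set \<Rightarrow> nat"

definition maximal_cells :: "'m weighted_complex \<Rightarrow> (real^'m) set set" where
  "maximal_cells \<Sigma> = {\<tau> \<in> cells \<Sigma>. \<forall>\<tau>'\<in>cells \<Sigma>. \<tau> \<subseteq> \<tau>' \<longrightarrow> \<tau>' = \<tau>}"

definition neg_complex :: "'m::finite weighted_complex \<Rightarrow> 'm weighted_complex" where
  "neg_complex \<Sigma> = \<lparr>cells = (\<lambda>\<sigma>. uminus ` \<sigma>) ` cells \<Sigma>, mult = (\<lambda>\<sigma>. mult \<Sigma> (uminus ` \<sigma>))\<rparr>"

definition set_add :: "(real^'m) set \<Rightarrow> (real^'m) set \<Rightarrow> (real^'m) set" where
  "set_add A B = {x + y | x y. x \<in> A \<and> y \<in> B}"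

definition direction_space :: "(real^'m::finite) set \<Rightarrow> (real^'m) set" where
  "direction_space \<sigma> = span {x - y | x y. x \<in> \<sigma> \<and> y \<in> \<sigma>}"

definition int_lattice :: "(real^'m) set" where
  "int_lattice = {x. \<forall>i. x $ i \<in> \<int>}"

definition lattice_of :: "(real^'m::finite) set \<Rightarrow> (real^'m) set" where
  "lattice_of \<tau> = int_lattice \<inter> direction_space \<tau>"

definition lattice_index :: "(real^'m::finite) set \<Rightarrow> nat" where
  "lattice_index N =
     card (int_lattice // {(x, y). x \<in> int_lattice \<and> y \<in> int_lattice \<and> x - y \<in> N})"

definition stable_cells :: "'m::finite weighted_complex \<Rightarrow> 'm weighted_complex \<Rightarrow> (real^'m) set set"
  where "stable_cells \<Sigma>\<^sub>1 \<Sigma>\<^sub>2 =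
     {\<sigma>\<^sub>1 \<inter> \<sigma>\<^sub>2 | \<sigma>\<^sub>1 \<sigma>\<^sub>2. \<sigma>\<^sub>1 \<in> cells \<Sigma>\<^sub>1 \<and> \<sigma>\<^sub>2 \<in> cells \<Sigma>\<^sub>2 \<and> aff_dim (set_add \<sigma>\<^sub>1 \<sigma>\<^sub>2) = int CARD('m)}"

text \<open>Genericity makes the translate of the second complex transverse to the first: a cell of the
  first meets a small translate of a cell of the second along \<open>u\<close> only if their sum is
  full-dimensional.  In particular the index in the multiplicity below is finite for each pair
  that contributes.\<close>

definition generic_direction :: "'m::finite weighted_complex \<Rightarrow> 'm weighted_complex \<Rightarrow> real^'m \<Rightarrow> bool"
  where "generic_direction \<Sigma>\<^sub>1 \<Sigma>\<^sub>2 u \<longleftrightarrow>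
     (\<forall>\<sigma>\<^sub>1\<in>cells \<Sigma>\<^sub>1. \<forall>\<sigma>\<^sub>2\<in>cells \<Sigma>\<^sub>2.
        set_add (direction_space \<sigma>\<^sub>1) (direction_space \<sigma>\<^sub>2) \<noteq> UNIV \<longrightarrow>
        u \<notin> set_add (direction_space \<sigma>\<^sub>1) (direction_space \<sigma>\<^sub>2))"

definition displaced_mult ::
    "'m::finite weighted_complex \<Rightarrow> 'm weighted_complex \<Rightarrow> real^'m \<Rightarrow> (real^'m) set \<Rightarrow> nat" where
  "displaced_mult \<Sigma>\<^sub>1 \<Sigma>\<^sub>2 u \<rho> =
     (\<Sum>(\<tau>\<^sub>1, \<tau>\<^sub>2) \<in> {(\<tau>\<^sub>1, \<tau>\<^sub>2). \<tau>\<^sub>1 \<in> maximal_cells \<Sigma>\<^sub>1 \<and> \<tau>\<^sub>2 \<in> maximal_cells \<Sigma>\<^sub>2 \<and>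
           \<rho> \<subseteq> \<tau>\<^sub>1 \<and> \<rho> \<subseteq> \<tau>\<^sub>2 \<and>
           (\<forall>\<^sub>F \<epsilon> in at_right 0. \<tau>\<^sub>1 \<inter> (\<lambda>x. x + \<epsilon> *\<^sub>R u) ` \<tau>\<^sub>2 \<noteq> {})}.
        mult \<Sigma>\<^sub>1 \<tau>\<^sub>1 * mult \<Sigma>\<^sub>2 \<tau>\<^sub>2 * lattice_index (set_add (lattice_of \<tau>\<^sub>1) (lattice_of \<tau>\<^sub>2)))"

text \<open>For balanced complexes the value does not depend on the chosen generic direction.\<close>

definition stable_mult ::
    "'m::finite weighted_complex \<Rightarrow> 'm weighted_complex \<Rightarrow> (real^'m) set \<Rightarrow> nat" where
  "stable_mult \<Sigma>\<^sub>1 \<Sigma>\<^sub>2 \<rho> = displaced_mult \<Sigma>\<^sub>1 \<Sigma>\<^sub>2 (SOME u. generic_direction \<Sigma>\<^sub>1 \<Sigma>\<^sub>2 u) \<rho>"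


section \<open>Tropicalization and the galactic pairing\<close>

definition ind_vec :: "'m set \<Rightarrow> real^'m" where
  "ind_vec F = (\<chi> i. indicator F i)"

definition chain_cone :: "('v, 'm::finite) multigraph \<Rightarrow> 'm set list \<Rightarrow> (real^'m) set" where
  "chain_cone H Fs =
     {(\<Sum>F\<in>set Fs. c F *\<^sub>R ind_vec F) + t *\<^sub>R ind_vec (edges H) | c t. \<forall>F\<in>set Fs. 0 \<le> c F}"

text \<open>For a multigraph whose edge set is not all of \<open>'m\<close>, the ambient space is embedded in
  \<open>real^'m\<close> by extending with zeros.\<close>

definition connected_trop_cones :: "('v, 'm::finite) multigraph \<Rightarrow> (real^'m) set set" where
  "connected_trop_cones H = chain_cone H ` {Fs. flat_chain H Fs}"

text \<open>The coordinate subspaces of the components are independent, so a product of cones is their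
  Minkowski sum.  A component without edges contributes a zero-dimensional factor and is left out:
  it has no proper flats.\<close>

definition trop :: "('v, 'm::finite) multigraph \<Rightarrow> 'm weighted_complex" where
  "trop H = (let K = {C \<in> components_of H. edges C \<noteq> {}} in
     \<lparr>cells = {{\<Sum>C\<in>K. y C | y. \<forall>C\<in>K. y C \<in> \<sigma> C} | \<sigma>. \<forall>C\<in>K. \<sigma> C \<in> connected_trop_cones C},
      mult = (\<lambda>_. 1)\<rparr>)"

definition galactic_pairing :: "('v, 'm::finite) multigraph \<Rightarrow> ('v, 'm) multigraph \<Rightarrow> nat" where
  "galactic_pairing H H' =
     (if stable_cells (trop H) (neg_complex (trop H')) = {} then 0
      else stable_mult (trop H) (neg_complex (trop H')) (span {ind_vec UNIV}))"

end

theory Submission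
  imports Defs
begin

text \<open>
  Excising along a maximal chain of flats splits off the reduced flats \<open>P\<^sub>1, \<dots>, P\<^sub>n\<^sub>-\<^sub>1\<close> one by
  one as isolated multiedges, while the rest of the graph remains a copy of the contraction of \<open>G\<close>
  by the current flat.  The tropicalization of the result is therefore a single linear space, the
  span \<open>L\<close> of the indicator vectors of the reduced flats, and the pairing is the index of
  \<open>(L \<inter> \<int>\<^sup>m) + (L' \<inter> \<int>\<^sup>m)\<close> in \<open>\<int>\<^sup>m\<close> if \<open>L + L' = \<real>\<^sup>m\<close>, and \<open>0\<close> otherwise.
  If the intersection graph is a tree, deleting the edge \<open>i\<close> splits it in two, and the signed sum of
  the indicator vectors on one side is the unit vector of \<open>i\<close>, so the index is \<open>1\<close>.  Conversely, a cycle
  gives an alternating functional vanishing on \<open>L + L'\<close>, and if the intersection graph is disconnected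
  then its \<open>2n - 2 = m + 1\<close> vertices satisfy two independent linear relations, so that
  \<open>dim (L + L') < m\<close>.
\<close>

section \<open>Connectivity and flats\<close>

text \<open>The edge set is a parameter of its own, so that one graph \<open>G\<close> carries the
  components of all its flats. The relation lives on the whole vertex type, which makes it an
  equivalence relation without side conditions.\<close>

definition conn :: "('v, 'e) multigraph \<Rightarrow> 'e set \<Rightarrow> ('v \<times> 'v) set" where
  "conn G F = (adj (G\<lparr>edges := F\<rparr>))\<^sup>*"

lemma conn_refl [simp]: "(u, u) \<in> conn G F"
  by (simp add: conn_def)

lemma conn_trans: "(u, v) \<in> conn G F \<Longrightarrow> (v, w) \<in> conn G F \<Longrightarrow> (u, w) \<in> conn G F"
  by (simp add: conn_def)

lemma conn_sym: "(u, v) \<in> conn G F \<Longrightarrow> (v, u) \<in> conn G F"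
proof -
  have "sym (adj (G\<lparr>edges := F\<rparr>))"
    by (auto simp: sym_def adj_def insert_commute)
  then show "(u, v) \<in> conn G F \<Longrightarrow> (v, u) \<in> conn G F"
    unfolding conn_def by (meson sym_rtrancl symD)
qed

lemma conn_commute: "(u, v) \<in> conn G F \<longleftrightarrow> (v, u) \<in> conn G F"
  using conn_sym by metis

lemma conn_edge: "e \<in> F \<Longrightarrow> ends G e = {u, v} \<Longrightarrow> (u, v) \<in> conn G F"
  by (auto simp: conn_def adj_def)

lemma conn_mono: "F \<subseteq> F' \<Longrightarrow> conn G F \<subseteq> conn G F'"
  unfolding conn_def by (rule rtrancl_mono) (auto simp: adj_def)

text \<open>\<open>conn G F\<close> is the least equivalence relation containing the pairs of ends
  of the edges in \<open>F\<close>; this supplies the upper bound in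
  \<open>conn_merge\<close>.\<close>

lemma conn_subset:
  assumes "trans R" "refl R" "sym R"
    and "\<And>e u v. e \<in> F \<Longrightarrow> ends G e = {u, v} \<Longrightarrow> (u, v) \<in> R"
  shows "conn G F \<subseteq> R"
proof -
  have "(u, v) \<in> R" if "(u, v) \<in> (adj (G\<lparr>edges := F\<rparr>))\<^sup>*" for u v
    using that
  proof induction
    case base
    then show ?case using \<open>refl R\<close> by (auto simp: refl_on_def)
  next
    case (step v w)
    then have "(v, w) \<in> R" using assms(4) by (auto simp: adj_def)
    with step show ?case using \<open>trans R\<close> by (meson transD)
  qed
  then show ?thesis by (auto simp: conn_def)
qed

lemma conn_empty: "conn G {} = Id"
  by (auto simp: conn_def adj_def)

lemma conn_edges: "conn G (edges G) = (adj G)\<^sup>*"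
  by (simp add: conn_def)

lemma wf_endsE:
  assumes "wf_multigraph G" "e \<in> edges G"
  obtains u v where "ends G e = {u, v}" "u \<noteq> v" "u \<in> verts G" "v \<in> verts G"
  using assms unfolding wf_multigraph_def by (force simp: card_2_iff)

text \<open>This is the closure form of a matroid flat. An edge belongs to the subgraph induced by a
  component of \<open>F\<close> exactly when \<open>F\<close> connects its two ends, so flatness
  says that such edges are already in \<open>F\<close>.\<close>

lemma is_flat_iff:
  assumes wf: "wf_multigraph G"
  shows "is_flat G F \<longleftrightarrow> F \<subseteq> edges G \<and>
    (\<forall>e\<in>edges G. \<forall>u v. ends G e = {u, v} \<longrightarrow> (u, v) \<in> conn G F \<longrightarrow> e \<in> F)" (is "?l \<longleftrightarrow> ?r")
proof -
  have l: "?l \<longleftrightarrow> F \<subseteq> edges G \<and> (\<forall>u\<in>verts G.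
      {e \<in> F. ends G e \<subseteq> {v \<in> verts G. (u, v) \<in> conn G F}} =
      {e \<in> edges G. ends G e \<subseteq> {v \<in> verts G. (u, v) \<in> conn G F}})"
    by (simp add: is_flat_def components_of_def induced_subgraph_def conn_def)
  show ?thesis
  proof
    assume ?l
    show ?r
    proof (intro conjI ballI allI impI)
      show "F \<subseteq> edges G" using \<open>?l\<close> by (simp add: is_flat_def)
      fix e u v assume e: "e \<in> edges G" "ends G e = {u, v}" "(u, v) \<in> conn G F"
      then have "u \<in> verts G" "v \<in> verts G" using wf by (auto simp: wf_multigraph_def)
      with e \<open>?l\<close> have "e \<in> {e \<in> F. ends G e \<subseteq> {v \<in> verts G. (u, v) \<in> conn G F}}"
        unfolding l by auto
      then show "e \<in> F" by simp
    qed
  next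
    assume r: ?r
    have "e \<in> F" if "e \<in> edges G" "ends G e \<subseteq> {v \<in> verts G. (u, v) \<in> conn G F}" for e u
    proof -
      obtain a b where "ends G e = {a, b}" using wf_endsE[OF wf \<open>e \<in> edges G\<close>] by metis
      then show ?thesis using that r by (metis (mono_tags, lifting) insert_subset mem_Collect_eq conn_sym conn_trans)
    qed
    then show ?l unfolding l using r by blast
  qed
qed

lemma is_flat_edges: "wf_multigraph G \<Longrightarrow> is_flat G (edges G)"
  by (simp add: is_flat_iff)

lemma is_flat_empty: "wf_multigraph G \<Longrightarrow> is_flat G {}"
  by (auto simp: is_flat_iff conn_empty elim: wf_endsE)

text \<open>If \<open>F\<close> does not connect \<open>a\<close> and \<open>b\<close>, these are
  the edges joining their images in the contraction of \<open>G\<close> by \<open>F\<close>: a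
  multiedge of the contraction, or nothing.\<close>

definition between :: "('v, 'e) multigraph \<Rightarrow> 'e set \<Rightarrow> 'v \<Rightarrow> 'v \<Rightarrow> 'e set" where
  "between G F a b = {e \<in> edges G. \<exists>x y. ends G e = {x, y} \<and> (a, x) \<in> conn G F \<and> (b, y) \<in> conn G F}"

lemma between_iff:
  assumes "e \<in> edges G" "ends G e = {x, y}"
  shows "e \<in> between G F a b \<longleftrightarrow> (a, x) \<in> conn G F \<and> (b, y) \<in> conn G F \<or>
    (a, y) \<in> conn G F \<and> (b, x) \<in> conn G F"
  unfolding between_def mem_Collect_eq assms(2) doubleton_eq_iff using assms(1) by metis

text \<open>A single edge \<open>e\<close> already joins the two classes, so the classes of
  \<open>a\<close> and \<open>b\<close> become one and all others stay. The right-hand side is an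
  equivalence relation containing the ends of all edges involved, which bounds connectivity from
  above by \<open>conn_subset\<close>.\<close>

lemma conn_merge:
  assumes "e \<in> between G F a b"
  shows "(x, y) \<in> conn G (F \<union> between G F a b) \<longleftrightarrow>
    (x, y) \<in> conn G F \<or> (a, x) \<in> conn G F \<and> (b, y) \<in> conn G F \<or>
    (b, x) \<in> conn G F \<and> (a, y) \<in> conn G F" (is "?l \<longleftrightarrow> ?r x y")
proof
  let ?c = "conn G (F \<union> between G F a b)"
  have mono: "conn G F \<subseteq> ?c" by (rule conn_mono) simp
  obtain p q where "ends G e = {p, q}" "(a, p) \<in> conn G F" "(b, q) \<in> conn G F"
    using assms by (auto simp: between_def)
  then have ab: "(a, b) \<in> ?c"
    using mono conn_edge[of e _ G p q] assms by (metis UnI2 conn_sym conn_trans subsetD)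
  assume "?r x y" then show ?l
    using mono ab by (meson conn_sym conn_trans subsetD)
next
  have c: "conn G (F \<union> between G F a b) \<subseteq> {(x, y). ?r x y}"
  proof (rule conn_subset)
    show "trans {(x, y). ?r x y}"
      unfolding trans_def by (auto; meson conn_sym conn_trans)
    show "refl {(x, y). ?r x y}" by (simp add: refl_on_def)
    show "sym {(x, y). ?r x y}" unfolding sym_def by (auto intro: conn_sym)
    fix e u v assume e: "e \<in> F \<union> between G F a b" "ends G e = {u, v}"
    show "(u, v) \<in> {(x, y). ?r x y}"
    proof (cases "e \<in> F")
      case True
      then show ?thesis using conn_edge[OF True e(2)] by simp
    next
      case False
      then show ?thesis using e by (auto simp: between_def doubleton_eq_iff)
    qed
  qed
  show "?l \<Longrightarrow> ?r x y" using c by blast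
qed

lemma is_flat_merge:
  assumes wf: "wf_multigraph G" and F: "is_flat G F" and e: "e \<in> between G F a b"
  shows "is_flat G (F \<union> between G F a b)"
  unfolding is_flat_iff[OF wf]
proof (intro conjI ballI allI impI)
  show "F \<union> between G F a b \<subseteq> edges G"
    using F by (auto simp: is_flat_def between_def)
  fix f u v
  assume f: "f \<in> edges G" "ends G f = {u, v}" "(u, v) \<in> conn G (F \<union> between G F a b)"
  from f(3)[unfolded conn_merge[OF e]] show "f \<in> F \<union> between G F a b"
    using f(1,2) F[unfolded is_flat_iff[OF wf]] by (auto simp: between_def insert_commute)
qed

text \<open>Any edge \<open>e\<close> of \<open>F' - F\<close> with ends \<open>a\<close> and
  \<open>b\<close> determines the flat \<open>F \<union> between G F a b\<close>, which lies in
  \<open>F'\<close> since \<open>F'\<close> connects \<open>a\<close> to \<open>b\<close>. It is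
  strictly larger than \<open>F\<close>, so it is \<open>F'\<close>. Covers of flats are thus given
  by multiedges of contractions.\<close>

lemma flat_cover:
  assumes wf: "wf_multigraph G" and F: "is_flat G F" and F': "is_flat G F'" and "F \<subset> F'"
    and cover: "\<And>K. is_flat G K \<Longrightarrow> F \<subset> K \<Longrightarrow> K \<subseteq> F' \<Longrightarrow> K = F'"
  obtains a b e where "a \<in> verts G" "b \<in> verts G" "(a, b) \<notin> conn G F"
    "e \<in> between G F a b" "F' = F \<union> between G F a b" "F' - F = between G F a b"
proof -
  obtain e where e: "e \<in> F'" "e \<notin> F" using \<open>F \<subset> F'\<close> by blast
  then have eE: "e \<in> edges G" using F' by (auto simp: is_flat_def)
  then obtain a b where ab: "ends G e = {a, b}" "a \<in> verts G" "b \<in> verts G"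
    using wf_endsE[OF wf] by metis
  have nc: "(a, b) \<notin> conn G F" using F e eE ab by (auto simp: is_flat_iff[OF wf])
  have eb: "e \<in> between G F a b" using eE ab conn_refl[of _ G F] unfolding between_def by blast
  have abF': "(a, b) \<in> conn G F'" using conn_edge[of e F' G a b] e ab by simp
  have mono: "conn G F \<subseteq> conn G F'" using \<open>F \<subset> F'\<close> by (simp add: conn_mono psubset_imp_subset)
  have "F \<union> between G F a b \<subseteq> F'"
  proof -
    have "f \<in> F'" if "f \<in> between G F a b" for f
    proof -
      obtain x y where xy: "f \<in> edges G" "ends G f = {x, y}" "(a, x) \<in> conn G F'" "(b, y) \<in> conn G F'"
        using \<open>f \<in> between G F a b\<close> mono by (auto simp: between_def)
      then have "(x, y) \<in> conn G F'" using abF' by (meson conn_sym conn_trans)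
      then show ?thesis using F' xy by (auto simp: is_flat_iff[OF wf])
    qed
    then show ?thesis using \<open>F \<subset> F'\<close> by blast
  qed
  then have eq: "F \<union> between G F a b = F'"
    using cover[OF is_flat_merge[OF wf F eb]] e eb by blast
  have "F \<inter> between G F a b = {}"
  proof -
    have False if f: "f \<in> F" "f \<in> between G F a b" for f
    proof -
      obtain x y where xy: "ends G f = {x, y}" "(a, x) \<in> conn G F" "(b, y) \<in> conn G F"
        using f by (auto simp: between_def)
      then have "(x, y) \<in> conn G F" using conn_edge[OF f(1) xy(1)] by simp
      then show False using xy nc by (meson conn_sym conn_trans)
    qed
    then show ?thesis by blast
  qed
  then show thesis using that[OF ab(2,3) nc eb] eq by blast
qed

section \<open>Connectedness of Laman graphs\<close>

lemma laman_connected: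
  assumes "laman G"
  shows "connected_graph G"
  unfolding connected_graph_def
proof (intro conjI ballI)
  have wf: "wf_multigraph G" and card_E: "int (card (edges G)) = 2 * int (card (verts G)) - 3"
    and sub: "\<And>W. W \<subseteq> verts G \<Longrightarrow> 2 \<le> card W \<Longrightarrow>
        int (card (edges (induced_subgraph G W))) \<le> 2 * int (card W) - 3"
    using assms by (auto simp: laman_def simple_graph_def)
  have finV: "finite (verts G)" and finE: "finite (edges G)"
    using wf by (auto simp: wf_multigraph_def)
  show "verts G \<noteq> {}" using card_E by auto
  \<comment> \<open>The Laman bound weakened by one also covers single vertices, which induce no
    edge. Splitting the vertices into two nonempty parts without edges between them then allows at
    most 2n - 4 edges, one too few.\<close>
  have bound: "int (card (edges (induced_subgraph G W))) \<le> 2 * int (card W) - 2"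
    if W: "W \<subseteq> verts G" "W \<noteq> {}" for W
  proof (cases "2 \<le> card W")
    case True
    then show ?thesis using sub[OF W(1)] by simp
  next
    case False
    have "finite W" using W finV finite_subset by blast
    then have c1: "card W = 1" using W False
      by (metis One_nat_def card_gt_0_iff le_neq_implies_less less_2_cases_iff not_less_eq_eq numeral_2_eq_2 linorder_not_le)
    have "edges (induced_subgraph G W) = {}"
    proof -
      have False if "e \<in> edges G" "ends G e \<subseteq> W" for e
      proof -
        have "card (ends G e) = 2" using wf that by (auto simp: wf_multigraph_def)
        then show False using card_mono[OF \<open>finite W\<close> that(2)] c1 by simp
      qed
      then show ?thesis by (auto simp: induced_subgraph_def)
    qed
    then show ?thesis using c1 by simp
  qed
  fix u v assume u: "u \<in> verts G" and v: "v \<in> verts G"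
  show "(u, v) \<in> (adj G)\<^sup>*"
  proof (rule ccontr)
    assume nc: "(u, v) \<notin> (adj G)\<^sup>*"
    define W where "W = {x \<in> verts G. (u, x) \<in> conn G (edges G)}"
    have W: "W \<subseteq> verts G" "W \<noteq> {}" "verts G - W \<noteq> {}"
      using u v nc by (auto simp: W_def conn_edges)
    have "edges G \<subseteq> edges (induced_subgraph G W) \<union> edges (induced_subgraph G (verts G - W))"
    proof
      fix e assume e: "e \<in> edges G"
      then obtain a b where ab: "ends G e = {a, b}" "a \<in> verts G" "b \<in> verts G"
        using wf_endsE[OF wf] by metis
      then have "(a, b) \<in> conn G (edges G)" using conn_edge[OF e ab(1)] by simp
      then have "a \<in> W \<longleftrightarrow> b \<in> W" using ab unfolding W_def by (auto intro: conn_trans conn_sym)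
      then show "e \<in> edges (induced_subgraph G W) \<union> edges (induced_subgraph G (verts G - W))"
        using e ab by (auto simp: induced_subgraph_def)
    qed
    then have "card (edges G) \<le> card (edges (induced_subgraph G W) \<union> edges (induced_subgraph G (verts G - W)))"
      by (rule card_mono[rotated]) (use finE in \<open>auto simp: induced_subgraph_def\<close>)
    also have "\<dots> \<le> card (edges (induced_subgraph G W)) + card (edges (induced_subgraph G (verts G - W)))"
      by (rule card_Un_le)
    finally have "int (card (edges G)) \<le> 2 * int (card W) - 2 + (2 * int (card (verts G - W)) - 2)"
      using bound[OF W(1,2)] bound[OF _ W(3)] by simp
    moreover have "card (verts G) = card W + card (verts G - W)"
      using finV W(1) by (metis card_Diff_subset card_mono finite_subset le_add_diff_inverse)
    ultimately show False using card_E by simp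
  qed
qed

section \<open>Excision along a maximal chain\<close>

text \<open>
  The state after excising the parts in \<open>Q\<close> from \<open>G\<close>: \<open>g\<close> gives the end points of the multiedges
  already split off, and \<open>\<phi>\<close> maps the vertices of \<open>G\<close> to those of the remaining component, which is a
  copy of the contraction of \<open>G\<close> by \<open>\<Union>Q\<close>.
\<close>

definition excision_state :: "('v, 'e) multigraph \<Rightarrow> 'e set set \<Rightarrow> ('v, 'e) multigraph \<Rightarrow>
    ('v \<Rightarrow> 'v) \<Rightarrow> ('e set \<Rightarrow> 'v set) \<Rightarrow> bool" where
  "excision_state G Q H \<phi> g \<longleftrightarrow>
     edges H = edges G \<and> finite (verts H) \<and> \<Union>Q \<subseteq> edges G \<and>
     (\<forall>u\<in>verts G. \<forall>v\<in>verts G. \<phi> u = \<phi> v \<longleftrightarrow> (u, v) \<in> conn G (\<Union>Q)) \<and>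
     (\<forall>e\<in>edges G - \<Union>Q. ends H e = \<phi> ` ends G e) \<and>
     (\<forall>P\<in>Q. card (g P) = 2 \<and> (\<forall>e\<in>P. ends H e = g P) \<and> g P \<inter> \<phi> ` verts G = {}) \<and>
     (\<forall>P\<in>Q. \<forall>P'\<in>Q. P \<noteq> P' \<longrightarrow> g P \<inter> g P' = {}) \<and>
     verts H = \<phi> ` verts G \<union> \<Union>(g ` Q)"

lemma excision_stateD:
  assumes "excision_state G Q H \<phi> g"
  shows "edges H = edges G" "finite (verts H)" "\<Union>Q \<subseteq> edges G"
    "\<And>u v. u \<in> verts G \<Longrightarrow> v \<in> verts G \<Longrightarrow> \<phi> u = \<phi> v \<longleftrightarrow> (u, v) \<in> conn G (\<Union>Q)"
    "\<And>e. e \<in> edges G \<Longrightarrow> e \<notin> \<Union>Q \<Longrightarrow> ends H e = \<phi> ` ends G e"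
    "\<And>P. P \<in> Q \<Longrightarrow> card (g P) = 2"
    "\<And>P e. P \<in> Q \<Longrightarrow> e \<in> P \<Longrightarrow> ends H e = g P"
    "\<And>P. P \<in> Q \<Longrightarrow> g P \<inter> \<phi> ` verts G = {}"
    "\<And>P P'. P \<in> Q \<Longrightarrow> P' \<in> Q \<Longrightarrow> P \<noteq> P' \<Longrightarrow> g P \<inter> g P' = {}"
    "verts H = \<phi> ` verts G \<union> \<Union>(g ` Q)"
proof -
  note a = assms[unfolded excision_state_def]
  show "edges H = edges G" "finite (verts H)" "\<Union>Q \<subseteq> edges G" "verts H = \<phi> ` verts G \<union> \<Union>(g ` Q)"
    using a by argo+
  show "\<phi> u = \<phi> v \<longleftrightarrow> (u, v) \<in> conn G (\<Union>Q)" if "u \<in> verts G" "v \<in> verts G" for u v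
    using a[THEN conjunct2, THEN conjunct2, THEN conjunct2, THEN conjunct1] that by metis
  show "ends H e = \<phi> ` ends G e" if "e \<in> edges G" "e \<notin> \<Union>Q" for e
    using a[THEN conjunct2, THEN conjunct2, THEN conjunct2, THEN conjunct2, THEN conjunct1] that
    by (metis DiffI)
  fix P assume P: "P \<in> Q"
  have b: "card (g P) = 2 \<and> (\<forall>e\<in>P. ends H e = g P) \<and> g P \<inter> \<phi> ` verts G = {}"
    using a[THEN conjunct2, THEN conjunct2, THEN conjunct2, THEN conjunct2, THEN conjunct2, THEN conjunct1] P
    by metis
  then show "card (g P) = 2" "g P \<inter> \<phi> ` verts G = {}" by simp_all
  show "ends H e = g P" if "e \<in> P" for e using b that by simp
  show "g P \<inter> g P' = {}" if "P' \<in> Q" "P \<noteq> P'" for P'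
    using a[THEN conjunct2, THEN conjunct2, THEN conjunct2, THEN conjunct2, THEN conjunct2, THEN conjunct2, THEN conjunct1] P that
    by metis
qed

lemma excision_state_init:
  assumes "wf_multigraph G"
  shows "excision_state G {} G id g"
  using assms unfolding excision_state_def wf_multigraph_def by (simp add: conn_empty image_id)

lemma ends_between_iff:
  assumes wf: "wf_multigraph G" and st: "excision_state G Q H \<phi> g"
    and ab: "a \<in> verts G" "b \<in> verts G"
    and e: "e \<in> edges G" "e \<notin> \<Union>Q"
  shows "ends H e = {\<phi> a, \<phi> b} \<longleftrightarrow> e \<in> between G (\<Union>Q) a b"
proof -
  note std = excision_stateD[OF st]
  obtain x y where xy: "ends G e = {x, y}" "x \<in> verts G" "y \<in> verts G"
    using wf_endsE[OF wf e(1)] by metis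
  have "ends H e = {\<phi> x, \<phi> y}" using std(5)[OF e] xy(1) by simp
  then have "ends H e = {\<phi> a, \<phi> b} \<longleftrightarrow> \<phi> x = \<phi> a \<and> \<phi> y = \<phi> b \<or> \<phi> x = \<phi> b \<and> \<phi> y = \<phi> a"
    by (simp only: doubleton_eq_iff)
  also have "\<dots> \<longleftrightarrow> e \<in> between G (\<Union>Q) a b"
    by (simp only: between_iff[OF e(1) xy(1)] std(4) ab xy(2,3)
      conn_commute[of x] conn_commute[of y]) argo
  finally show ?thesis .
qed

lemma ends_between:
  assumes wf: "wf_multigraph G" and st: "excision_state G Q H \<phi> g"
    and ab: "a \<in> verts G" "b \<in> verts G" and nc: "(a, b) \<notin> conn G (\<Union>Q)"
    and e: "e \<in> between G (\<Union>Q) a b"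
  shows "ends H e = {\<phi> a, \<phi> b}" "e \<in> edges G" "e \<notin> \<Union>Q"
proof -
  show E: "e \<in> edges G" using e by (auto simp: between_def)
  show n: "e \<notin> \<Union>Q"
  proof
    assume "e \<in> \<Union>Q"
    moreover obtain x y where xy: "ends G e = {x, y}" "(a, x) \<in> conn G (\<Union>Q)" "(b, y) \<in> conn G (\<Union>Q)"
      using e by (auto simp: between_def)
    ultimately have "(x, y) \<in> conn G (\<Union>Q)" using conn_edge[of e "\<Union>Q" G x y] by simp
    then show False using xy nc by (meson conn_sym conn_trans)
  qed
  show "ends H e = {\<phi> a, \<phi> b}"
    using ends_between_iff[OF wf st ab E n] e by simp
qed

text \<open>Multiedges split off earlier sit on vertices outside the image of \<open>\<phi>\<close>,
  so none of their edges joins \<open>\<phi> a\<close> to \<open>\<phi> b\<close>.\<close>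

lemma excision_state_multiedge:
  assumes wf: "wf_multigraph G" and st: "excision_state G Q H \<phi> g"
    and ab: "a \<in> verts G" "b \<in> verts G" and nc: "(a, b) \<notin> conn G (\<Union>Q)"
    and e: "e \<in> between G (\<Union>Q) a b"
  shows "is_multiedge H (between G (\<Union>Q) a b)"
proof -
  note std = excision_stateD[OF st]
  have ne: "\<phi> a \<noteq> \<phi> b" using std(4) ab nc by blast
  have *: "f \<in> between G (\<Union>Q) a b" if f: "f \<in> edges G" "ends H f = {\<phi> a, \<phi> b}" for f
  proof (cases "f \<in> \<Union>Q")
    case True
    then obtain P where "P \<in> Q" "f \<in> P" by blast
    then have "g P \<inter> \<phi> ` verts G = {}" "ends H f = g P" using std(7,8) by auto
    then show ?thesis using f ab by auto
  next
    case False
    then show ?thesis using ends_between_iff[OF wf st ab f(1)] f(2) by simp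
  qed
  have "between G (\<Union>Q) a b = {f \<in> edges H. ends H f = {\<phi> a, \<phi> b}}"
    unfolding std(1) using ends_between(1,2)[OF wf st ab nc] * by blast
  with ne show ?thesis using e unfolding is_multiedge_def by blast
qed

text \<open>The excised multiedge keeps the vertices \<open>\<phi> a\<close> and
  \<open>\<phi> b\<close>, which become its pair under \<open>g'\<close>, while everything else at
  these vertices moves to the new vertex \<open>w\<close>. So \<open>\<phi>'\<close> sends the
  merged class of \<open>a\<close> and \<open>b\<close> to \<open>w\<close>, and its image has two
  old vertices fewer and one new vertex more.\<close>

lemma excision_state_step:
  fixes G H :: "('v::infinite, 'e) multigraph"
  assumes wf: "wf_multigraph G" and st: "excision_state G Q H \<phi> g"
    and ab: "a \<in> verts G" "b \<in> verts G" and nc: "(a, b) \<notin> conn G (\<Union>Q)"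
    and e: "e \<in> between G (\<Union>Q) a b"
  obtains \<phi>' g' where
    "excision_state G (insert (between G (\<Union>Q) a b) Q) (excise H (between G (\<Union>Q) a b)) \<phi>' g'"
    "Suc (card (\<phi>' ` verts G)) = card (\<phi> ` verts G)"
proof -
  note std = excision_stateD[OF st]
  note eb = ends_between[OF wf st ab nc]
  let ?B = "between G (\<Union>Q) a b"
  let ?S = "{\<phi> a, \<phi> b}"
  define w where "w = (SOME w. w \<notin> verts H)"
  have w: "w \<notin> verts H" unfolding w_def
    by (rule someI_ex) (use std(2) ex_new_if_finite infinite_UNIV in blast)
  then have w\<phi>: "w \<notin> \<phi> ` verts G" and wg: "\<And>P. P \<in> Q \<Longrightarrow> w \<notin> g P" using std(10) by auto
  have S: "(\<Union>e\<in>?B. ends H e) = ?S" using e eb(1) by auto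
  have exc: "excise H ?B = H\<lparr>verts := insert w (verts H),
      ends := (\<lambda>e. if e \<in> ?B \<or> ends H e \<inter> ?S = {} then ends H e
                   else insert w (ends H e - ?S))\<rparr>"
    unfolding excise_def Let_def S w_def[symmetric] ..
  define \<phi>' where "\<phi>' u = (if \<phi> u \<in> ?S then w else \<phi> u)" for u
  define g' where "g' = g(?B := ?S)"
  have gS: "g P \<inter> ?S = {}" if "P \<in> Q" for P using std(8)[OF that] ab by blast
  have BQ: "?B \<notin> Q" using e eb(3)[OF e] by blast
  have g': "\<And>P. P \<in> Q \<Longrightarrow> g' P = g P" "g' ?B = ?S" using BQ by (auto simp: g'_def)
  have ne: "\<phi> a \<noteq> \<phi> b" using std(4) ab nc by blast
  have im: "\<phi>' ` verts G = insert w (\<phi> ` verts G - ?S)"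
    using ab by (auto simp: \<phi>'_def image_iff)
  have U: "\<Union>(insert ?B Q) = \<Union>Q \<union> ?B" by blast
  have "excision_state G (insert ?B Q) (excise H ?B) \<phi>' g'"
    unfolding excision_state_def
  proof (intro conjI ballI impI)
    show "edges (excise H ?B) = edges G" by (simp add: exc std(1))
    show "finite (verts (excise H ?B))" by (simp add: exc std(2))
    show "\<Union>(insert ?B Q) \<subseteq> edges G" using std(3) by (auto simp: between_def)
    show "verts (excise H ?B) = \<phi>' ` verts G \<union> \<Union>(g' ` insert ?B Q)"
    proof -
      have "\<Union>(g' ` insert ?B Q) = ?S \<union> \<Union>(g ` Q)" using g' by auto
      then show ?thesis unfolding im using ab by (auto simp: exc std(10))
    qed
    fix u v assume uv: "u \<in> verts G" "v \<in> verts G"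
    show "\<phi>' u = \<phi>' v \<longleftrightarrow> (u, v) \<in> conn G (\<Union>(insert ?B Q))"
    proof -
      \<comment> \<open>Since \<open>w\<close> is not a value of \<open>\<phi>\<close>, the only new
        identifications under \<open>\<phi>'\<close> are those between the fibres of
        \<open>\<phi> a\<close> and \<open>\<phi> b\<close>; this is the disjunction in
        \<open>conn_merge\<close>.\<close>
      have "\<phi> u \<noteq> w" "\<phi> v \<noteq> w" using w\<phi> uv by auto
      then have "\<phi>' u = \<phi>' v \<longleftrightarrow> \<phi> u = \<phi> v \<or> \<phi> a = \<phi> u \<and> \<phi> b = \<phi> v \<or> \<phi> b = \<phi> u \<and> \<phi> a = \<phi> v"
        by (auto simp: \<phi>'_def)
      then show ?thesis unfolding U conn_merge[OF e] using std(4) uv ab by simp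
    qed
  next
    fix f assume f: "f \<in> edges G - \<Union>(insert ?B Q)"
    then have fH: "ends H f = \<phi> ` ends G f" using std(5) by simp
    obtain x y where xy: "ends G f = {x, y}" "x \<in> verts G" "y \<in> verts G"
      using wf_endsE[OF wf] f by (metis DiffD1)
    have "ends H f \<noteq> ?S" using ends_between_iff[OF wf st ab] f by simp
    then show "ends (excise H ?B) f = \<phi>' ` ends G f"
      using f fH xy unfolding exc by (auto simp: \<phi>'_def)
  next
    fix P assume P: "P \<in> insert ?B Q"
    show "card (g' P) = 2" using P g' ne std(6) by auto
    show "g' P \<inter> \<phi>' ` verts G = {}"
    proof (cases "P = ?B")
      case True
      have "w \<notin> ?S" using w\<phi> ab by blast
      then show ?thesis unfolding True im g'(2) by blast
    next
      case False
      then have PQ: "P \<in> Q" using P by simp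
      show ?thesis unfolding im g'(1)[OF PQ] using std(8)[OF PQ] wg[OF PQ] by blast
    qed
    fix f assume f: "f \<in> P"
    show "ends (excise H ?B) f = g' P"
    proof (cases "P = ?B")
      case True
      then show ?thesis using f eb(1) g' by (simp add: exc)
    next
      case False
      then have PQ: "P \<in> Q" using P by simp
      then have "ends H f \<inter> ?S = {}" using std(7)[OF PQ f] gS[OF PQ] by simp
      then show ?thesis using g'(1)[OF PQ] std(7)[OF PQ f] by (simp add: exc)
    qed
  next
    fix P P' assume "P \<in> insert ?B Q" "P' \<in> insert ?B Q" "P \<noteq> P'"
    then consider "P = ?B" "P' \<in> Q" | "P' = ?B" "P \<in> Q" | "P \<in> Q" "P' \<in> Q" "P \<noteq> P'"
      by blast
    then show "g' P \<inter> g' P' = {}"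
    proof cases
      case 1
      then show ?thesis using gS[of P'] g'(1)[of P'] g'(2) by (simp add: Int_commute)
    next
      case 2
      then show ?thesis using gS[of P] g'(1)[of P] g'(2) by simp
    next
      case 3
      then show ?thesis using std(9)[of P P'] g'(1) by simp
    qed
  qed
  moreover have "Suc (card (\<phi>' ` verts G)) = card (\<phi> ` verts G)"
  proof -
    have fin: "finite (\<phi> ` verts G)" using wf by (simp add: wf_multigraph_def)
    have "card ?S = 2" "?S \<subseteq> \<phi> ` verts G" using ne ab by auto
    then have "card (\<phi> ` verts G - ?S) = card (\<phi> ` verts G) - 2" "2 \<le> card (\<phi> ` verts G)"
      using fin card_Diff_subset[of ?S "\<phi> ` verts G"] card_mono[of "\<phi> ` verts G" ?S] by auto
    then show ?thesis unfolding im using w\<phi> fin by simp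
  qed
  ultimately show thesis by (rule that)
qed

text \<open>The images under \<open>\<phi>\<close> of all vertices of the connected graph
  \<open>G\<close> lie in a single component of \<open>H\<close>, together with every edge not yet
  split off. If the multiedge were the edge set of this component, no further edge would remain,
  against \<open>proper\<close>.\<close>

lemma excision_state_not_isolated:
  assumes wf: "wf_multigraph G" and con: "connected_graph G" and st: "excision_state G Q H \<phi> g"
    and ab: "a \<in> verts G" "b \<in> verts G" and nc: "(a, b) \<notin> conn G (\<Union>Q)"
    and e: "e \<in> between G (\<Union>Q) a b" and proper: "\<Union>Q \<union> between G (\<Union>Q) a b \<noteq> edges G"
  shows "\<not> is_isolated H (between G (\<Union>Q) a b)"
proof
  note std = excision_stateD[OF st]
  assume "is_isolated H (between G (\<Union>Q) a b)"
  then obtain u where u: "u \<in> verts H"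
    and "edges (induced_subgraph H {v \<in> verts H. (u, v) \<in> (adj H)\<^sup>*}) = between G (\<Union>Q) a b"
    unfolding is_isolated_def components_of_def by blast
  then have B: "between G (\<Union>Q) a b = {f \<in> edges G. ends H f \<subseteq> {v \<in> verts H. (u, v) \<in> (adj H)\<^sup>*}}"
    by (simp add: induced_subgraph_def std(1))
  then have ua: "(u, \<phi> a) \<in> (adj H)\<^sup>*"
    using e ends_between(1)[OF wf st ab nc e] by auto
  \<comment> \<open>Walks of \<open>G\<close> are pushed forward by \<open>\<phi>\<close>: an edge
    of an excised part is collapsed to a point, any other edge goes to itself in
    \<open>H\<close>.\<close>
  have reach: "(\<phi> a, \<phi> x) \<in> (adj H)\<^sup>*" if "(a, x) \<in> (adj G)\<^sup>*" for x
    using that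
  proof induction
    case base
    show ?case by simp
  next
    case (step y z)
    then obtain f where f: "f \<in> edges G" "ends G f = {y, z}" by (auto simp: adj_def)
    then have yz: "y \<in> verts G" "z \<in> verts G" using wf by (auto simp: wf_multigraph_def)
    show ?case
    proof (cases "f \<in> \<Union>Q")
      case True
      then have "\<phi> y = \<phi> z" using conn_edge[OF True f(2)] std(4)[OF yz] by blast
      then show ?thesis using step by simp
    next
      case False
      then have "ends H f = {\<phi> y, \<phi> z}" using std(5)[OF f(1)] f(2) by simp
      then have "(\<phi> y, \<phi> z) \<in> adj H" using f(1) std(1) by (auto simp: adj_def)
      then show ?thesis using step by simp
    qed
  qed
  have "f \<in> between G (\<Union>Q) a b" if f: "f \<in> edges G" "f \<notin> \<Union>Q" for f
  proof -
    obtain x y where xy: "ends G f = {x, y}" "x \<in> verts G" "y \<in> verts G"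
      using wf_endsE[OF wf f(1)] by metis
    have "(a, x) \<in> (adj G)\<^sup>*" "(a, y) \<in> (adj G)\<^sup>*"
      using con xy ab by (auto simp: connected_graph_def)
    then have "(u, \<phi> x) \<in> (adj H)\<^sup>*" "(u, \<phi> y) \<in> (adj H)\<^sup>*"
      using reach ua by (meson rtrancl_trans)+
    moreover have "\<phi> x \<in> verts H" "\<phi> y \<in> verts H" using std(10) xy by blast+
    ultimately show ?thesis unfolding B using std(5)[OF f] xy(1) f(1) by simp
  qed
  then show False using proper std(3) by (auto simp: between_def)
qed

text \<open>The shape of the fully excised graph, with the pairs of end points recorded explicitly
  and no reference to \<open>G\<close>. Components and tropicalization are computed from this
  form.\<close>

definition multiedge_union :: "('v, 'e) multigraph \<Rightarrow> 'e set set \<Rightarrow> ('e set \<Rightarrow> 'v set) \<Rightarrow> bool" where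
  "multiedge_union H Q g \<longleftrightarrow> edges H = \<Union>Q \<and> verts H = \<Union>(g ` Q) \<and>
     (\<forall>P\<in>Q. P \<noteq> {} \<and> card (g P) = 2 \<and> (\<forall>e\<in>P. ends H e = g P)) \<and>
     (\<forall>P\<in>Q. \<forall>P'\<in>Q. P \<noteq> P' \<longrightarrow> g P \<inter> g P' = {})"

text \<open>The last part needs no excision. When it completes the edge set, just the classes of
  \<open>a\<close> and \<open>b\<close> are left, so the image of \<open>\<phi>\<close> is one pair
  of vertices and carries exactly this multiedge. This is why \<open>chain_excision\<close> takes
  \<open>butlast\<close>.\<close>

lemma excision_state_final:
  assumes wf: "wf_multigraph G" and con: "connected_graph G" and st: "excision_state G Q H \<phi> g"
    and ab: "a \<in> verts G" "b \<in> verts G" and nc: "(a, b) \<notin> conn G (\<Union>Q)"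
    and e: "e \<in> between G (\<Union>Q) a b" and all: "\<Union>Q \<union> between G (\<Union>Q) a b = edges G"
    and ne: "{} \<notin> Q"
  obtains g' where "multiedge_union H (insert (between G (\<Union>Q) a b) Q) g'"
    "card (\<phi> ` verts G) = 2"
proof -
  note std = excision_stateD[OF st]
  note eb = ends_between[OF wf st ab nc]
  let ?B = "between G (\<Union>Q) a b"
  define g' where "g' = g(?B := {\<phi> a, \<phi> b})"
  have BQ: "?B \<notin> Q" using e eb(3)[OF e] by blast
  have g': "g' P = g P" if "P \<in> Q" for P using BQ that by (auto simp: g'_def)
  have g'B: "g' ?B = {\<phi> a, \<phi> b}" by (simp add: g'_def)
  have "\<phi> x = \<phi> a \<or> \<phi> x = \<phi> b" if x: "x \<in> verts G" for x
  proof -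
    have "(a, x) \<in> conn G (\<Union>Q \<union> ?B)"
      unfolding all conn_edges using con x ab by (simp add: connected_graph_def)
    then show ?thesis unfolding conn_merge[OF e] using std(4) x ab by metis
  qed
  then have im: "\<phi> ` verts G = {\<phi> a, \<phi> b}" using ab by auto
  have ne': "\<phi> a \<noteq> \<phi> b" using std(4) ab nc by blast
  have gS: "g P \<inter> {\<phi> a, \<phi> b} = {}" if "P \<in> Q" for P using std(8)[OF that] im by simp
  have "multiedge_union H (insert ?B Q) g'"
    unfolding multiedge_union_def
  proof (intro conjI)
    show "edges H = \<Union>(insert ?B Q)" using all std(1) by (simp add: Un_commute)
    have "g' ` Q = g ` Q" using g' by (rule image_cong[OF refl])
    then show "verts H = \<Union>(g' ` insert ?B Q)"
      unfolding std(10) im by (simp add: g'B)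
    have "?B \<noteq> {} \<and> card (g' ?B) = 2 \<and> (\<forall>e\<in>?B. ends H e = g' ?B)"
      unfolding g'B using eb(1) ne' e by auto
    moreover have "P \<noteq> {} \<and> card (g' P) = 2 \<and> (\<forall>e\<in>P. ends H e = g' P)" if "P \<in> Q" for P
      unfolding g'[OF that] using std(6,7)[OF that] that ne by metis
    ultimately show "\<forall>P\<in>insert ?B Q. P \<noteq> {} \<and> card (g' P) = 2 \<and> (\<forall>e\<in>P. ends H e = g' P)"
      by blast
    show "\<forall>P\<in>insert ?B Q. \<forall>P'\<in>insert ?B Q. P \<noteq> P' \<longrightarrow> g' P \<inter> g' P' = {}"
    proof (intro ballI impI)
      fix P P' assume "P \<in> insert ?B Q" "P' \<in> insert ?B Q" "P \<noteq> P'"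
      then consider "P = ?B" "P' \<in> Q" | "P' = ?B" "P \<in> Q" | "P \<in> Q" "P' \<in> Q" "P \<noteq> P'"
        by blast
      then show "g' P \<inter> g' P' = {}"
      proof cases
        case 1
        then show ?thesis using gS[of P'] g'[of P'] g'B by (simp add: Int_commute)
      next
        case 2
        then show ?thesis using gS[of P] g'[of P] g'B by simp
      next
        case 3
        then show ?thesis using std(9)[of P P'] g' by simp
      qed
    qed
  qed
  then show thesis using that im ne' by simp
qed

section \<open>Maximal chains of flats\<close>

lemma flat_chain_nth:
  assumes wf: "wf_multigraph G" and chain: "flat_chain G Fs"
  defines "Es \<equiv> Fs @ [edges G]"
  shows "Es ! 0 = {}"
    and "\<And>j. j \<le> length Fs \<Longrightarrow> is_flat G (Es ! j)"
    and "\<And>i j. i < j \<Longrightarrow> j \<le> length Fs \<Longrightarrow> Es ! i \<subset> Es ! j"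
proof -
  have c: "Fs \<noteq> []" "hd Fs = {}" "sorted_wrt (\<subset>) Fs" "\<And>F. F \<in> set Fs \<Longrightarrow> is_flat G F \<and> F \<noteq> edges G"
    using chain by (auto simp: flat_chain_def)
  show "Es ! 0 = {}" using c by (simp add: Es_def nth_append hd_conv_nth)
  show fl: "is_flat G (Es ! j)" if "j \<le> length Fs" for j
    using that c(4) is_flat_edges[OF wf] by (auto simp: Es_def nth_append)
  have "F \<subset> edges G" if "F \<in> set Fs" for F using c(4)[OF that] by (auto simp: is_flat_def)
  then have "sorted_wrt (\<subset>) Es"
    unfolding Es_def sorted_wrt_append using c(3) by simp
  then show "Es ! i \<subset> Es ! j" if "i < j" "j \<le> length Fs" for i j
    using that by (auto simp: sorted_wrt_iff_nth_less Es_def)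
qed

text \<open>A flat strictly between two neighbours could be inserted into the list, giving a longer
  chain of proper flats.\<close>

lemma maximal_flat_chain_cover:
  assumes wf: "wf_multigraph G" and max: "maximal_flat_chain G Fs"
  defines "Es \<equiv> Fs @ [edges G]"
  assumes j: "j < length Fs" and K: "is_flat G K" "Es ! j \<subset> K" "K \<subseteq> Es ! Suc j"
  shows "K = Es ! Suc j"
proof (rule ccontr)
  assume ne: "K \<noteq> Es ! Suc j"
  then have KS: "K \<subset> Es ! Suc j" using K by blast
  have chain: "flat_chain G Fs" using max by (simp add: maximal_flat_chain_def)
  note nth = flat_chain_nth[OF wf chain, folded Es_def]
  have c: "Fs \<noteq> []" "hd Fs = {}" "sorted_wrt (\<subset>) Fs" "\<forall>F\<in>set Fs. is_flat G F \<and> F \<noteq> edges G"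
    using chain by (auto simp: flat_chain_def)
  have Fs_nth: "Fs ! i = Es ! i" if "i < length Fs" for i using that by (simp add: Es_def nth_append)
  have lower: "F \<subset> K" if F: "F \<in> set (take (Suc j) Fs)" for F
  proof -
    obtain i where "i < Suc j" "F = Fs ! i" using F j by (auto simp: in_set_conv_nth)
    then have "F \<subseteq> Es ! j" using nth(3)[of i j] j Fs_nth[of i] by (cases "i = j") auto
    then show ?thesis using K by blast
  qed
  have upper: "K \<subset> F" if F: "F \<in> set (drop (Suc j) Fs)" for F
  proof -
    obtain i where i: "i < length Fs - Suc j" "F = Fs ! (Suc j + i)" using F by (auto simp: in_set_conv_nth)
    then have "F = Es ! (Suc j + i)" using Fs_nth by simp
    moreover have "Suc j + i \<le> length Fs" using i(1) by simp
    ultimately have "Es ! Suc j \<subseteq> F" using nth(3)[of "Suc j" "Suc j + i"]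
      by (cases "i = 0") auto
    then show ?thesis using KS by blast
  qed
  let ?Fs' = "take (Suc j) Fs @ K # drop (Suc j) Fs"
  have sorted: "sorted_wrt (\<subset>) (take (Suc j) Fs @ drop (Suc j) Fs)" using c(3) by simp
  have "sorted_wrt (\<subset>) ?Fs'"
    using sorted lower upper unfolding sorted_wrt_append by auto
  moreover have "K \<noteq> edges G"
    using KS nth(2)[of "Suc j"] j by (auto simp: is_flat_def)
  moreover have "\<forall>F\<in>set (take (Suc j) Fs) \<union> set (drop (Suc j) Fs). is_flat G F \<and> F \<noteq> edges G"
    using c(4) by (meson UnE in_set_dropD in_set_takeD)
  moreover have "hd ?Fs' = {}" using c(1,2) by (cases Fs) auto
  ultimately have "flat_chain G ?Fs'" using K(1) unfolding flat_chain_def by auto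
  moreover have "set Fs \<subseteq> set ?Fs'"
    by (metis Un_subset_iff append_take_drop_id set_append set_subset_Cons subset_refl sup.coboundedI1 sup.coboundedI2)
  ultimately have "?Fs' = Fs" using max by (simp only: maximal_flat_chain_def)
  then have "length ?Fs' = length Fs" by simp
  then show False using j by simp
qed

lemma reduced_flats_conv:
  "Fs \<noteq> [] \<Longrightarrow> reduced_flats G Fs =
    map (\<lambda>j. (Fs @ [edges G]) ! Suc j - (Fs @ [edges G]) ! j) [0..<length Fs]"
  unfolding reduced_flats_def
  by (rule nth_equalityI) (auto simp: nth_append nth_tl less_Suc_eq)

text \<open>Each step of a maximal chain is a cover, so \<open>flat_cover\<close> makes each reduced
  flat a multiedge of the current contraction. Each excision lowers the number of vertices of the
  contraction by one, starting from n; two are left when only the last reduced flat remains, so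
  there are n - 1 reduced flats.\<close>

lemma chain_excision_structure:
  fixes G :: "('v::infinite, 'e) multigraph"
  assumes wf: "wf_multigraph G" and con: "connected_graph G" and max: "maximal_flat_chain G Fs"
  obtains g where "chain_excision G Fs \<in> gamma_vertices G"
    "multiedge_union (chain_excision G Fs) (set (reduced_flats G Fs)) g"
    "Suc (length (reduced_flats G Fs)) = card (verts G)"
proof -
  \<comment> \<open>With the full edge set as last entry, every reduced flat, including the last, is
    a difference of consecutive entries.\<close>
  define Es where "Es = Fs @ [edges G]"
  define R where "R = reduced_flats G Fs"
  have chain: "flat_chain G Fs" using max by (simp add: maximal_flat_chain_def)
  then have ne: "Fs \<noteq> []" by (simp add: flat_chain_def)
  note nth = flat_chain_nth[OF wf chain, folded Es_def]
  have lenR: "length R = length Fs" and Rnth: "\<And>j. j < length Fs \<Longrightarrow> R ! j = Es ! Suc j - Es ! j"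
    unfolding R_def reduced_flats_conv[OF ne] Es_def by auto
  have cover: "\<exists>a b e. a \<in> verts G \<and> b \<in> verts G \<and> (a, b) \<notin> conn G (Es ! j) \<and>
      e \<in> between G (Es ! j) a b \<and> Es ! Suc j = Es ! j \<union> between G (Es ! j) a b \<and>
      R ! j = between G (Es ! j) a b" if j: "j < length Fs" for j
  proof -
    have "K = Es ! Suc j" if "is_flat G K" "Es ! j \<subset> K" "K \<subseteq> Es ! Suc j" for K
      using maximal_flat_chain_cover[OF wf max j, folded Es_def] that by blast
    then show ?thesis
      using flat_cover[OF wf nth(2)[of j] nth(2)[of "Suc j"] nth(3)[of j "Suc j"]] j Rnth[OF j]
      by (metis Suc_leI lessI less_imp_le)
  qed
  have main: "\<exists>\<phi> g. excision_state G (set (take j R)) (foldl excise G (take j R)) \<phi> g \<and>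
      \<Union>(set (take j R)) = Es ! j \<and> card (\<phi> ` verts G) + j = card (verts G) \<and>
      foldl excise G (take j R) \<in> gamma_vertices G \<and> {} \<notin> set (take j R)" if "j < length Fs" for j
    using that
  proof (induction j)
    case 0
    then show ?case using excision_state_init[OF wf] nth(1) gamma_vertices.base[of G] wf
      by (intro exI[of _ id]) (auto simp: id_def)
  next
    case (Suc j)
    then obtain \<phi> g where st: "excision_state G (set (take j R)) (foldl excise G (take j R)) \<phi> g"
      and U: "\<Union>(set (take j R)) = Es ! j" and card: "card (\<phi> ` verts G) + j = card (verts G)"
      and gam: "foldl excise G (take j R) \<in> gamma_vertices G" and ne: "{} \<notin> set (take j R)"
      by auto
    obtain a b e where c: "a \<in> verts G" "b \<in> verts G" "(a, b) \<notin> conn G (Es ! j)"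
      "e \<in> between G (Es ! j) a b" "Es ! Suc j = Es ! j \<union> between G (Es ! j) a b"
      "R ! j = between G (Es ! j) a b" using cover[of j] Suc by auto
    have tk: "take (Suc j) R = take j R @ [R ! j]"
      using Suc lenR by (simp add: take_Suc_conv_app_nth)
    have set: "set (take (Suc j) R) = insert (R ! j) (set (take j R))" using tk by simp
    have fold: "foldl excise G (take (Suc j) R) = excise (foldl excise G (take j R)) (R ! j)"
      using tk by simp
    obtain \<phi>' g' where st': "excision_state G (set (take (Suc j) R)) (foldl excise G (take (Suc j) R)) \<phi>' g'"
      "Suc (card (\<phi>' ` verts G)) = card (\<phi> ` verts G)"
      using excision_state_step[OF wf st c(1,2)] c unfolding set fold U by metis
    \<comment> \<open>Here \<open>Suc j < length Fs\<close>, so the flat reached is still proper and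
      some edge remains; this rules out isolation.\<close>
    have "Es ! Suc j \<noteq> edges G"
      using nth(3)[of "Suc j" "length Fs"] Suc by (auto simp: Es_def)
    then have "\<not> is_isolated (foldl excise G (take j R)) (R ! j)"
      using excision_state_not_isolated[OF wf con st c(1,2)] c unfolding U by metis
    moreover have "is_multiedge (foldl excise G (take j R)) (R ! j)"
      using excision_state_multiedge[OF wf st c(1,2)] c unfolding U by metis
    ultimately have "foldl excise G (take (Suc j) R) \<in> gamma_vertices G"
      unfolding fold using gam by (intro gamma_vertices.step)
    moreover have "\<Union>(set (take (Suc j) R)) = Es ! Suc j"
      unfolding set using U c by auto
    moreover have "{} \<notin> set (take (Suc j) R)" unfolding set using ne c(4,6) by auto
    ultimately show ?case using st' card by (intro exI[of _ \<phi>'] exI[of _ g']) auto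
  qed
  \<comment> \<open>The index of the last proper flat: the first \<open>k\<close> parts are excised,
    and part \<open>k\<close> is the one left over.\<close>
  define k where "k = length Fs - 1"
  have k: "k < length Fs" "length Fs = Suc k" using ne by (auto simp: k_def)
  obtain \<phi> g where st: "excision_state G (set (take k R)) (foldl excise G (take k R)) \<phi> g"
    and U: "\<Union>(set (take k R)) = Es ! k" and card: "card (\<phi> ` verts G) + k = card (verts G)"
    and gam: "foldl excise G (take k R) \<in> gamma_vertices G" and neR: "{} \<notin> set (take k R)"
    using main[OF k(1)] by auto
  obtain a b e where c: "a \<in> verts G" "b \<in> verts G" "(a, b) \<notin> conn G (Es ! k)"
      "e \<in> between G (Es ! k) a b" "Es ! Suc k = Es ! k \<union> between G (Es ! k) a b"
      "R ! k = between G (Es ! k) a b" using cover[OF k(1)] by auto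
  have all: "Es ! k \<union> between G (Es ! k) a b = edges G"
    using c(5) k by (simp add: Es_def nth_append)
  have set: "set R = insert (R ! k) (set (take k R))"
    using take_Suc_conv_app_nth[of k R] lenR k
    by (metis Un_insert_right empty_set list.simps(15) lessI set_append sup_bot.right_neutral take_all_iff order_refl)
  have ce: "chain_excision G Fs = foldl excise G (take k R)"
    unfolding chain_excision_def R_def[symmetric] butlast_conv_take lenR k_def by simp
  obtain g' where g': "multiedge_union (foldl excise G (take k R)) (set R) g'"
      "card (\<phi> ` verts G) = 2"
    using excision_state_final[OF wf con st c(1,2) _ _ _ neR, unfolded U, OF c(3,4) all, folded c(6), folded set]
    by metis
  show thesis
  proof (rule that)
    show "chain_excision G Fs \<in> gamma_vertices G" using gam ce by simp
    show "multiedge_union (chain_excision G Fs) (set (reduced_flats G Fs)) g'"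
      using g'(1) unfolding ce R_def .
    show "Suc (length (reduced_flats G Fs)) = card (verts G)"
      using card g'(2) lenR k unfolding R_def by simp
  qed
qed

section \<open>Components of a disjoint union of multiedges\<close>

lemma multiedge_union_component:
  assumes mu: "multiedge_union H Q g" and P: "P \<in> Q" and u: "u \<in> g P"
  shows "induced_subgraph H {v \<in> verts H. (u, v) \<in> (adj H)\<^sup>*} = H\<lparr>verts := g P, edges := P\<rparr>"
proof -
  have E: "edges H = \<Union>Q" and V: "verts H = \<Union>(g ` Q)"
    and p: "\<And>P. P \<in> Q \<Longrightarrow> P \<noteq> {} \<and> card (g P) = 2 \<and> (\<forall>e\<in>P. ends H e = g P)"
    and dis: "\<And>P P'. P \<in> Q \<Longrightarrow> P' \<in> Q \<Longrightarrow> P \<noteq> P' \<Longrightarrow> g P \<inter> g P' = {}"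
    using mu by (auto simp: multiedge_union_def)
  \<comment> \<open>A walk from \<open>u\<close> cannot leave the pair \<open>g P\<close>: an edge
    at one of its vertices belongs to a part whose pair meets \<open>g P\<close>, hence to
    \<open>P\<close>.\<close>
  have "v \<in> g P" if "(u, v) \<in> (adj H)\<^sup>*" for v
    using that
  proof induction
    case base
    show ?case by (rule u)
  next
    case (step v w)
    then obtain e where e: "e \<in> edges H" "ends H e = {v, w}" by (auto simp: adj_def)
    then obtain P' where P': "P' \<in> Q" "e \<in> P'" using E by blast
    then have "g P' = {v, w}" using p e by metis
    then show ?case using dis[OF P P'(1)] step.IH by blast
  qed
  moreover have "(u, v) \<in> (adj H)\<^sup>*" if v: "v \<in> g P" for v
  proof (cases "u = v")
    case False
    obtain e where e: "e \<in> P" using p[OF P] by blast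
    have "card (g P) = 2" using p[OF P] by simp
    then have "g P = {u, v}" using u v False by (auto simp: card_2_iff)
    then have "ends H e = {u, v}" using p[OF P] e by simp
    then have "(u, v) \<in> adj H" using e E P by (auto simp: adj_def)
    then show ?thesis by simp
  qed simp
  ultimately have W: "{v \<in> verts H. (u, v) \<in> (adj H)\<^sup>*} = g P"
    using V P by auto
  have "{e \<in> edges H. ends H e \<subseteq> g P} = P"
  proof (intro equalityI subsetI)
    fix e assume "e \<in> {e \<in> edges H. ends H e \<subseteq> g P}"
    then obtain P' where P': "P' \<in> Q" "e \<in> P'" "g P' \<subseteq> g P" using E p by blast
    have "g P' \<noteq> {}" using p[OF P'(1)] by auto
    then have "P' = P" using dis[OF P P'(1)] P'(3) by blast
    then show "e \<in> P" using P' by simp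
  next
    fix e assume "e \<in> P"
    then show "e \<in> {e \<in> edges H. ends H e \<subseteq> g P}" using p[OF P] P E by auto
  qed
  then show ?thesis unfolding W induced_subgraph_def by simp
qed

lemma multiedge_union_components:
  assumes mu: "multiedge_union H Q g"
  shows "components_of H = (\<lambda>P. H\<lparr>verts := g P, edges := P\<rparr>) ` Q"
proof -
  have V: "verts H = \<Union>(g ` Q)" and ne: "\<And>P. P \<in> Q \<Longrightarrow> g P \<noteq> {}"
    using mu by (auto simp: multiedge_union_def)
  show ?thesis
  proof (intro equalityI subsetI)
    fix C assume "C \<in> components_of H"
    then obtain u where u: "u \<in> verts H" "C = induced_subgraph H {v \<in> verts H. (u, v) \<in> (adj H)\<^sup>*}"
      unfolding components_of_def by blast
    then obtain P where "P \<in> Q" "u \<in> g P" using V by blast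
    then show "C \<in> (\<lambda>P. H\<lparr>verts := g P, edges := P\<rparr>) ` Q"
      using multiedge_union_component[OF mu] u by blast
  next
    fix C assume "C \<in> (\<lambda>P. H\<lparr>verts := g P, edges := P\<rparr>) ` Q"
    then obtain P where P: "P \<in> Q" "C = H\<lparr>verts := g P, edges := P\<rparr>" by blast
    obtain u where u: "u \<in> g P" using ne[OF P(1)] by blast
    then have "C = induced_subgraph H {v \<in> verts H. (u, v) \<in> (adj H)\<^sup>*}"
      using multiedge_union_component[OF mu P(1)] P by simp
    moreover have "u \<in> verts H" using u P V by blast
    ultimately show "C \<in> components_of H" unfolding components_of_def by blast
  qed
qed

lemma multiedge_union_fully_excised:
  assumes mu: "multiedge_union H Q g"
  shows "fully_excised H"
  unfolding fully_excised_def multiedge_union_components[OF mu]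
proof
  fix C assume "C \<in> (\<lambda>P. H\<lparr>verts := g P, edges := P\<rparr>) ` Q"
  then obtain P where P: "P \<in> Q" "C = H\<lparr>verts := g P, edges := P\<rparr>" by blast
  have E: "edges H = \<Union>Q"
    and p: "\<And>P. P \<in> Q \<Longrightarrow> P \<noteq> {} \<and> card (g P) = 2 \<and> (\<forall>e\<in>P. ends H e = g P)"
    and dis: "\<And>P P'. P \<in> Q \<Longrightarrow> P' \<in> Q \<Longrightarrow> P \<noteq> P' \<Longrightarrow> g P \<inter> g P' = {}"
    using mu by (auto simp: multiedge_union_def)
  obtain u v where uv: "g P = {u, v}" "u \<noteq> v" using p[OF P(1)] by (auto simp: card_2_iff)
  \<comment> \<open>Distinct parts have disjoint, hence different, pairs of end points, so no edge
    of another part is parallel to \<open>P\<close>.\<close>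
  have "P = {e \<in> edges H. ends H e = {u, v}}"
  proof (intro equalityI subsetI)
    fix e assume "e \<in> P"
    then show "e \<in> {e \<in> edges H. ends H e = {u, v}}" using p[OF P(1)] P E uv by auto
  next
    fix e assume "e \<in> {e \<in> edges H. ends H e = {u, v}}"
    then obtain P' where P': "P' \<in> Q" "e \<in> P'" "ends H e = g P" using E uv by auto
    then have "g P' = g P" using p by metis
    then have "P' = P" using dis[OF P(1) P'(1)] uv by auto
    then show "e \<in> P" using P' by simp
  qed
  then show "is_multiedge H (edges C)"
    unfolding is_multiedge_def using p[OF P(1)] uv(2) P(2) by auto
qed

lemma multiedge_union_disjoint:
  assumes mu: "multiedge_union H Q g" and P: "P \<in> Q" "P' \<in> Q" "e \<in> P" "e \<in> P'"
  shows "P = P'"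
proof (rule ccontr)
  assume "P \<noteq> P'"
  then have "g P \<inter> g P' = {}" using mu P(1,2) by (simp add: multiedge_union_def)
  moreover have "g P = ends H e" "g P' = ends H e" "card (g P) = 2"
    using mu P unfolding multiedge_union_def by metis+
  ultimately show False by simp
qed

section \<open>Pairs of partitions\<close>

lemma simple_pathE:
  assumes "(u, v) \<in> (adj H)\<^sup>*"
  obtains vs es where "distinct vs" "length vs = Suc (length es)" "hd vs = u" "last vs = v"
    "set es \<subseteq> edges H" "\<And>i. i < length es \<Longrightarrow> ends H (es ! i) = {vs ! i, vs ! Suc i}"
proof -
  have "\<exists>vs es. distinct vs \<and> length vs = Suc (length es) \<and> hd vs = u \<and> last vs = v \<and>
      set es \<subseteq> edges H \<and> (\<forall>i<length es. ends H (es ! i) = {vs ! i, vs ! Suc i})"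
    using assms
  proof induction
    case base
    show ?case by (intro exI[of _ "[u]"] exI[of _ "[]"]) simp
  next
    case (step v w)
    then obtain vs es where p: "distinct vs" "length vs = Suc (length es)" "hd vs = u" "last vs = v"
      "set es \<subseteq> edges H" "\<forall>i<length es. ends H (es ! i) = {vs ! i, vs ! Suc i}" by blast
    have ne: "vs \<noteq> []" using p(2) by auto
    obtain e where e: "e \<in> edges H" "ends H e = {v, w}" using step(2) by (auto simp: adj_def)
    show ?case
    proof (cases "w \<in> set vs")
      case True
      then obtain k where k: "k < length vs" "vs ! k = w" by (auto simp: in_set_conv_nth)
      \<comment> \<open>The walk returns to a vertex of the path, so the path is cut off there
        instead of being extended.\<close>
      have "last (take (Suc k) vs) = w" using k by (simp add: take_Suc_conv_app_nth)
      moreover have "set (take k es) \<subseteq> edges H" using p(5) by (meson set_take_subset subset_trans)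
      ultimately show ?thesis using p k ne
        by (intro exI[of _ "take (Suc k) vs"] exI[of _ "take k es"]) (auto simp: min_def hd_conv_nth)
    next
      case False
      have "ends H ((es @ [e]) ! i) = {(vs @ [w]) ! i, (vs @ [w]) ! Suc i}" if "i < Suc (length es)" for i
      proof (cases "i = length es")
        case True
        then show ?thesis using e p(2,4) ne by (simp add: nth_append last_conv_nth)
      next
        case False
        then show ?thesis using that p(2,6) by (simp add: nth_append)
      qed
      then show ?thesis using p False ne e
        by (intro exI[of _ "vs @ [w]"] exI[of _ "es @ [e]"]) auto
    qed
  qed
  then show thesis using that by blast
qed

text \<open>A path from \<open>u\<close> to \<open>v\<close> that avoids \<open>e\<close> is closed
  up by \<open>e\<close> to a cycle. Because \<open>u \<noteq> v\<close> the path has an edge, so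
  the cycle has length at least two; an edge parallel to \<open>e\<close> gives length exactly
  two.\<close>

lemma bridge_of_acyclic:
  assumes acyc: "\<nexists>vs es. is_cycle H vs es" and e: "e \<in> edges H" "ends H e = {u, v}" "u \<noteq> v"
  shows "(u, v) \<notin> (adj (H\<lparr>edges := edges H - {e}\<rparr>))\<^sup>*"
proof
  assume "(u, v) \<in> (adj (H\<lparr>edges := edges H - {e}\<rparr>))\<^sup>*"
  then obtain vs es where p: "distinct vs" "length vs = Suc (length es)" "hd vs = u" "last vs = v"
    "set es \<subseteq> edges H - {e}" "\<And>i. i < length es \<Longrightarrow> ends H (es ! i) = {vs ! i, vs ! Suc i}"
    by (rule simple_pathE) auto
  have ne: "vs \<noteq> []" using p(2) by auto
  have "es \<noteq> []" using p(2,3,4) e(3) ne by (cases vs) auto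
  have "distinct es"
    unfolding distinct_conv_nth
  proof (intro allI impI)
    fix i j assume ij: "i < length es" "j < length es" "i \<noteq> j"
    show "es ! i \<noteq> es ! j"
    proof
      assume "es ! i = es ! j"
      then have "{vs ! i, vs ! Suc i} = {vs ! j, vs ! Suc j}" using p(6) ij by metis
      then show False using ij p(1,2) by (auto simp: doubleton_eq_iff nth_eq_iff_index_eq)
    qed
  qed
  then have "is_cycle H vs (es @ [e])"
    unfolding is_cycle_def
  proof (intro conjI allI impI)
    show "2 \<le> length (es @ [e])" using \<open>es \<noteq> []\<close> by (cases es) auto
    show "distinct (es @ [e])" using \<open>distinct es\<close> p(5) by auto
    show "set (es @ [e]) \<subseteq> edges H" using p(5) e by auto
    fix i assume i: "i < length (es @ [e])"
    show "ends H ((es @ [e]) ! i) = {vs ! i, vs ! (Suc i mod length (es @ [e]))}"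
    proof (cases "i = length es")
      case True
      then show ?thesis using e(2) p(2,3,4) ne
        by (simp add: last_conv_nth hd_conv_nth insert_commute)
    next
      case False
      then show ?thesis using i p(6) by (simp add: nth_append)
    qed
  qed (use p in auto)
  then show False using acyc by blast
qed

section \<open>Partitions and the linear spaces they span\<close>

definition part_of :: "'m set set \<Rightarrow> 'm \<Rightarrow> 'm set" where
  "part_of Q i = (THE P. P \<in> Q \<and> i \<in> P)"

definition is_partition :: "'m set set \<Rightarrow> bool" where
  "is_partition Q \<longleftrightarrow> \<Union>Q = UNIV \<and> (\<forall>P\<in>Q. \<forall>P'\<in>Q. P \<inter> P' \<noteq> {} \<longrightarrow> P = P')"

lemma part_ofI:
  assumes "is_partition Q" "P \<in> Q" "i \<in> P"
  shows "part_of Q i = P"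
  unfolding part_of_def using assms by (intro the_equality) (auto simp: is_partition_def)

lemma part_of:
  assumes "is_partition Q"
  shows "part_of Q i \<in> Q" "i \<in> part_of Q i"
proof -
  obtain P where "P \<in> Q" "i \<in> P" using assms unfolding is_partition_def by blast
  then show "part_of Q i \<in> Q" "i \<in> part_of Q i" using part_ofI[OF assms] by auto
qed

lemma ind_vec_part:
  assumes "is_partition Q" "P \<in> Q"
  shows "ind_vec P $ i = (if P = part_of Q i then 1 else 0)"
proof (cases "i \<in> P")
  case True
  then show ?thesis using part_ofI[OF assms True] by (simp add: ind_vec_def)
next
  case False
  then have "P \<noteq> part_of Q i" using part_of(2)[OF assms(1), of i] by blast
  then show ?thesis using False by (simp add: ind_vec_def)
qed

text \<open>For a partition this is the span of the indicator vectors of its parts, see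
  \<open>part_space_eq_span\<close>. The description by coefficient functions makes integrality and
  linear functionals easy to evaluate.\<close>

definition part_space :: "'m set set \<Rightarrow> (real^'m::finite) set" where
  "part_space Q = {\<chi> i. c (part_of Q i) | c. True}"

lemma part_spaceI:
  fixes Q :: "'m::finite set set"
  shows "(\<chi> i. c (part_of Q i)) \<in> part_space Q"
  unfolding part_space_def by blast

lemma subspace_part_space:
  fixes Q :: "'m::finite set set"
  shows "subspace (part_space Q)"
  unfolding subspace_def part_space_def
proof safe
  show "\<exists>c. 0 = (\<chi> i. c (part_of Q i)) \<and> True"
    by (intro exI[of _ "\<lambda>_. 0"]) (simp add: vec_eq_iff)
  show "\<exists>e. (\<chi> i. c (part_of Q i)) + (\<chi> i. d (part_of Q i)) = (\<chi> i. e (part_of Q i)) \<and> True" for c d :: "'m set \<Rightarrow> real"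
    by (intro exI[of _ "\<lambda>P. c P + d P"]) (simp add: vec_eq_iff)
  show "\<exists>e. r *\<^sub>R (\<chi> i. c (part_of Q i)) = (\<chi> i. e (part_of Q i)) \<and> True" for r and c :: "'m set \<Rightarrow> real"
    by (intro exI[of _ "\<lambda>P. r * c P"]) (simp add: vec_eq_iff)
qed

lemma span_ones_subset_part_space: "span {ind_vec UNIV} \<subseteq> part_space Q"
proof (rule span_minimal[OF _ subspace_part_space])
  show "{ind_vec UNIV} \<subseteq> part_space Q"
    using part_spaceI[of "\<lambda>_. 1"] by (simp add: ind_vec_def)
qed

lemma part_space_sum:
  fixes Q :: "'m::finite set set"
  assumes Q: "is_partition Q"
  shows "(\<chi> i. c (part_of Q i)) = (\<Sum>P\<in>Q. c P *\<^sub>R ind_vec P)"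
proof -
  have "(\<Sum>P\<in>Q. c P *\<^sub>R ind_vec P) $ i = c (part_of Q i)" for i
  proof -
    have "c P * ind_vec P $ i = (if P = part_of Q i then c P else 0)" if "P \<in> Q" for P
      by (simp add: ind_vec_part[OF Q that])
    then have "(\<Sum>P\<in>Q. c P *\<^sub>R ind_vec P) $ i = (\<Sum>P\<in>Q. if P = part_of Q i then c P else 0)"
      by simp
    also have "\<dots> = c (part_of Q i)" using part_of[OF Q] by simp
    finally show ?thesis .
  qed
  then show ?thesis by (simp add: vec_eq_iff)
qed

lemma part_space_eq_span:
  fixes Q :: "'m::finite set set"
  assumes Q: "is_partition Q"
  shows "part_space Q = span (ind_vec ` Q)"
proof
  show "part_space Q \<subseteq> span (ind_vec ` Q)"
  proof
    fix x assume "x \<in> part_space Q"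
    then obtain c where "x = (\<Sum>P\<in>Q. c P *\<^sub>R ind_vec P)" unfolding part_space_def part_space_sum[OF Q] by blast
    then show "x \<in> span (ind_vec ` Q)" by (auto intro: span_sum span_scale span_base)
  qed
  have "ind_vec P \<in> part_space Q" if "P \<in> Q" for P
  proof -
    have "ind_vec P = (\<chi> i. if part_of Q i = P then 1 else 0)"
      by (auto simp: vec_eq_iff ind_vec_part[OF Q that])
    then show ?thesis using part_spaceI[of "\<lambda>R. if R = P then 1 else 0" Q] by simp
  qed
  then show "span (ind_vec ` Q) \<subseteq> part_space Q"
    by (intro span_minimal subspace_part_space) auto
qed

section \<open>The intersection graph of two partitions\<close>

definition part_graph :: "'m set set \<Rightarrow> 'm set set \<Rightarrow> ('m set + 'm set, 'm) multigraph" where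
  "part_graph Q Q' = \<lparr>verts = Inl ` Q \<union> Inr ` Q', edges = UNIV,
     ends = (\<lambda>i. {Inl (part_of Q i), Inr (part_of Q' i)})\<rparr>"

text \<open>In an acyclic graph the edge \<open>i\<close> is a bridge. Without it, every other edge
  has both ends inside or both outside the component \<open>D\<close> of the \<open>Q\<close>-end of
  \<open>i\<close>, so the difference of the indicators of \<open>D\<close> on the two sides
  vanishes at all coordinates except \<open>i\<close>, where it is 1.\<close>

lemma part_graph_acyclic_axis:
  fixes i :: "'m::finite"
  assumes acyc: "\<nexists>vs es. is_cycle (part_graph Q Q') vs es"
  obtains c d :: "'m set \<Rightarrow> real" where "range c \<subseteq> \<int>" "range d \<subseteq> \<int>"
    "axis i 1 = (\<chi> k. c (part_of Q k)) + (\<chi> k. d (part_of Q' k))"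
proof -
  let ?H = "part_graph Q Q'"
  let ?H' = "?H\<lparr>edges := edges ?H - {i}\<rparr>"
  define D where "D = {v. (Inl (part_of Q i), v) \<in> (adj ?H')\<^sup>*}"
  have "Inl (part_of Q k) \<in> D \<longleftrightarrow> Inr (part_of Q' k) \<in> D" if "k \<noteq> i" for k
  proof -
    have "(Inl (part_of Q k), Inr (part_of Q' k)) \<in> adj ?H'" "(Inr (part_of Q' k), Inl (part_of Q k)) \<in> adj ?H'"
      using that by (auto simp: adj_def part_graph_def)
    then show ?thesis
      unfolding D_def mem_Collect_eq using rtrancl.rtrancl_into_rtrancl[of _ _ "adj ?H'"] by blast
  qed
  moreover have "Inr (part_of Q' i) \<notin> D"
    unfolding D_def mem_Collect_eq by (rule bridge_of_acyclic[OF acyc]) (auto simp: part_graph_def)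
  moreover have "Inl (part_of Q i) \<in> D" by (simp add: D_def)
  ultimately have "axis i (1::real) = (\<chi> k. indicator D (Inl (part_of Q k))) + (\<chi> k. - indicator D (Inr (part_of Q' k)))"
    by (auto simp: vec_eq_iff axis_def indicator_def)
  moreover have "range (\<lambda>P. indicator D (Inl P) :: real) \<subseteq> \<int>" "range (\<lambda>P. - indicator D (Inr P) :: real) \<subseteq> \<int>"
    by (auto simp: indicator_def)
  ultimately show thesis using that by blast
qed

text \<open>The functional \<open>l\<close> sums the coordinates along the cycle with signs that
  alternate, as the graph is bipartite. It vanishes on both spaces but not on the unit vector of an
  edge of the cycle.\<close>

lemma part_graph_cycle_span:
  fixes Q Q' :: "'m::finite set set"
  assumes cyc: "is_cycle (part_graph Q Q') vs es"
  shows "set_add (part_space Q) (part_space Q') \<noteq> UNIV"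
proof
  assume U: "set_add (part_space Q) (part_space Q') = UNIV"
  define n where "n = length es"
  have n: "2 \<le> n" "distinct es"
    and ends: "\<And>j. j < n \<Longrightarrow> {Inl (part_of Q (es ! j)), Inr (part_of Q' (es ! j))} = {vs ! j, vs ! (Suc j mod n)}"
    using cyc by (auto simp: is_cycle_def n_def part_graph_def)
  define s :: "nat \<Rightarrow> real" where "s j = (if isl (vs ! j) then 1 else - 1)" for j
  define l :: "real^'m \<Rightarrow> real" where "l x = (\<Sum>j<n. s j * x $ (es ! j))" for x
  \<comment> \<open>Rotating the cycle by one position does not change a sum over its vertices, so
    the differences of neighbouring values below add up to zero.\<close>
  have shift: "(\<Sum>j<n. f (vs ! (Suc j mod n))) = (\<Sum>j<n. f (vs ! j))" for f :: "'m set + 'm set \<Rightarrow> real"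
  proof -
    obtain k where k: "n = Suc k" using n by (cases n) auto
    have "(\<Sum>j<n. f (vs ! (Suc j mod n))) = (\<Sum>j<k. f (vs ! (Suc j mod n))) + f (vs ! (Suc k mod n))"
      by (simp add: k)
    also have "\<dots> = (\<Sum>j<k. f (vs ! Suc j)) + f (vs ! 0)" by (simp add: k)
    also have "\<dots> = (\<Sum>j<n. f (vs ! j))" unfolding k by (subst sum.lessThan_Suc_shift) simp
    finally show ?thesis .
  qed
  have lQ: "l (\<chi> i. c (part_of Q i)) = 0" for c
  proof -
    \<comment> \<open>Extended by zero to the other side, \<open>c\<close> turns each signed summand
      into a difference of neighbouring values, whichever way the edge is traversed.\<close>
    define f where "f v = (case v of Inl P \<Rightarrow> c P | Inr _ \<Rightarrow> 0)" for v :: "'m set + 'm set"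
    have "s j * c (part_of Q (es ! j)) = f (vs ! j) - f (vs ! (Suc j mod n))" if j: "j < n" for j
    proof -
      consider "vs ! j = Inl (part_of Q (es ! j))" "vs ! (Suc j mod n) = Inr (part_of Q' (es ! j))"
        | "vs ! j = Inr (part_of Q' (es ! j))" "vs ! (Suc j mod n) = Inl (part_of Q (es ! j))"
        using ends[OF j] unfolding doubleton_eq_iff by metis
      then show ?thesis by cases (simp_all add: s_def f_def)
    qed
    then have "l (\<chi> i. c (part_of Q i)) = (\<Sum>j<n. f (vs ! j)) - (\<Sum>j<n. f (vs ! (Suc j mod n)))"
      by (simp add: l_def sum_subtractf)
    then show ?thesis using shift by simp
  qed
  have lQ': "l (\<chi> i. c (part_of Q' i)) = 0" for c
  proof -
    define f where "f v = (case v of Inl _ \<Rightarrow> 0 | Inr P \<Rightarrow> c P)" for v :: "'m set + 'm set"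
    have "s j * c (part_of Q' (es ! j)) = f (vs ! (Suc j mod n)) - f (vs ! j)" if j: "j < n" for j
    proof -
      consider "vs ! j = Inl (part_of Q (es ! j))" "vs ! (Suc j mod n) = Inr (part_of Q' (es ! j))"
        | "vs ! j = Inr (part_of Q' (es ! j))" "vs ! (Suc j mod n) = Inl (part_of Q (es ! j))"
        using ends[OF j] unfolding doubleton_eq_iff by metis
      then show ?thesis by cases (simp_all add: s_def f_def)
    qed
    then have "l (\<chi> i. c (part_of Q' i)) = (\<Sum>j<n. f (vs ! (Suc j mod n))) - (\<Sum>j<n. f (vs ! j))"
      by (simp add: l_def sum_subtractf)
    then show ?thesis using shift by simp
  qed
  have add: "l (x + y) = l x + l y" for x y
    by (simp add: l_def algebra_simps sum.distrib)
  have "axis (es ! 0) 1 \<in> set_add (part_space Q) (part_space Q')" using U by simp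
  then have "l (axis (es ! 0) 1) = 0"
    unfolding set_add_def part_space_def using add lQ lQ' by auto
  \<comment> \<open>Since the edges of a cycle are distinct, just the summand for position 0
    survives, and it is a sign.\<close>
  moreover have "l (axis (es ! 0) 1) = (\<Sum>j<n. if j = 0 then s j else 0)"
    unfolding l_def
  proof (intro sum.cong refl)
    fix j assume "j \<in> {..<n}"
    then have "es ! j = es ! 0 \<longleftrightarrow> j = 0"
      using n nth_eq_iff_index_eq[of es j 0] by (cases es) (auto simp: n_def)
    then show "s j * axis (es ! 0) 1 $ (es ! j) = (if j = 0 then s j else 0)" by (simp add: axis_def)
  qed
  ultimately have "s 0 = 0" using n by simp
  then show False by (simp add: s_def split: if_splits)
qed

text \<open>The vertices carry at most m + 1 indicator vectors, with m = \<open>CARD('m)\<close>,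
  and these span the whole space. In a disconnected graph the component of \<open>u\<close> and its
  complement each give a linear relation, which makes two vectors dispensable and leaves fewer than
  m.\<close>

lemma part_graph_connected:
  fixes Q Q' :: "'m::finite set set"
  assumes Q: "is_partition Q" "is_partition Q'"
    and card: "card Q + card Q' \<le> Suc CARD('m)"
    and U: "set_add (part_space Q) (part_space Q') = UNIV"
  shows "connected_graph (part_graph Q Q')"
  unfolding connected_graph_def
proof (intro conjI ballI)
  let ?H = "part_graph Q Q'"
  let ?V = "verts ?H"
  have V: "?V = Inl ` Q \<union> Inr ` Q'" by (simp add: part_graph_def)
  have fin: "finite ?V" unfolding V by simp
  show "?V \<noteq> {}" unfolding V using part_of(1)[OF Q(1)] by blast
  fix u v assume u: "u \<in> ?V" and v: "v \<in> ?V"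
  show "(u, v) \<in> (adj ?H)\<^sup>*"
  proof (rule ccontr)
    assume nuv: "(u, v) \<notin> (adj ?H)\<^sup>*"
    define T where "T = {w \<in> ?V. (u, w) \<in> (adj ?H)\<^sup>*}"
    have T: "u \<in> T" "v \<notin> T" "T \<subseteq> ?V" using u nuv by (auto simp: T_def)
    have closed: "Inl (part_of Q k) \<in> T \<longleftrightarrow> Inr (part_of Q' k) \<in> T" for k
    proof -
      have "(Inl (part_of Q k), Inr (part_of Q' k)) \<in> adj ?H" "(Inr (part_of Q' k), Inl (part_of Q k)) \<in> adj ?H"
        by (auto simp: adj_def part_graph_def)
      then show ?thesis unfolding T_def V using part_of(1)[OF Q(1)] part_of(1)[OF Q(2)]
        using rtrancl.rtrancl_into_rtrancl[of _ _ "adj ?H"] by blast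
    qed
    \<comment> \<open>With these signs the vectors of each union of components sum to zero.\<close>
    define b :: "'m set + 'm set \<Rightarrow> real^'m" where
      "b w = (case w of Inl P \<Rightarrow> ind_vec P | Inr P \<Rightarrow> - ind_vec P)" for w
    have zero: "(\<Sum>w\<in>S. b w) = 0"
      if S: "S \<subseteq> ?V" and cl: "\<And>k. Inl (part_of Q k) \<in> S \<longleftrightarrow> Inr (part_of Q' k) \<in> S" for S
    proof -
      have "(\<Sum>w\<in>S. b w) $ k = 0" for k
      proof -
        have fS: "finite S" using S fin finite_subset by blast
        have "b w $ k = (if w = Inl (part_of Q k) then 1 else 0) - (if w = Inr (part_of Q' k) then 1 else 0)"
          if "w \<in> S" for w
        proof -
          have "w \<in> Inl ` Q \<union> Inr ` Q'" using that S V by blast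
          then show ?thesis by (auto simp: b_def ind_vec_part[OF Q(1)] ind_vec_part[OF Q(2)] split: if_splits)
        qed
        then have "(\<Sum>w\<in>S. b w) $ k = (\<Sum>w\<in>S. (if w = Inl (part_of Q k) then 1 else 0) - (if w = Inr (part_of Q' k) then 1 else 0))"
          by simp
        also have "\<dots> = 0" using fS cl[of k] by (simp add: sum_subtractf)
        finally show ?thesis .
      qed
      then show ?thesis by (simp add: vec_eq_iff)
    qed
    \<comment> \<open>The vertex \<open>u\<close> lies in \<open>T\<close> and \<open>v\<close>
      outside it, so each of the two relations eliminates one of them.\<close>
    let ?B = "b ` (?V - {u, v})"
    have in_span: "b x \<in> span ?B" if x: "x \<in> S" "S - {x} \<subseteq> ?V - {u, v}" and S: "S \<subseteq> ?V" "(\<Sum>w\<in>S. b w) = 0" for x S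
    proof -
      have fS: "finite S" using S fin finite_subset by blast
      have "(\<Sum>w\<in>S. b w) = b x + (\<Sum>w\<in>S - {x}. b w)" using fS x by (simp add: sum.remove)
      then have "b x = - (\<Sum>w\<in>S - {x}. b w)" using S(2) by (simp add: eq_neg_iff_add_eq_0)
      also have "\<dots> \<in> span ?B" using x(2) by (intro span_neg span_sum span_base) blast
      finally show ?thesis .
    qed
    have "b u \<in> span ?B"
      by (rule in_span[OF T(1) _ T(3) zero[OF T(3) closed]]) (use T in blast)
    moreover have "b v \<in> span ?B"
    proof (rule in_span)
      show "v \<in> ?V - T" "?V - T - {v} \<subseteq> ?V - {u, v}" "?V - T \<subseteq> ?V" using T v by blast+
      show "(\<Sum>w\<in>?V - T. b w) = 0"
      proof (rule zero)
        show "Inl (part_of Q k) \<in> ?V - T \<longleftrightarrow> Inr (part_of Q' k) \<in> ?V - T" for k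
          using closed[of k] part_of(1)[OF Q(1), of k] part_of(1)[OF Q(2), of k] V by blast
      qed blast
    qed
    ultimately have bV: "b w \<in> span ?B" if w: "w \<in> ?V" for w
    proof (cases "w \<in> {u, v}")
      case False
      then show ?thesis using w by (intro span_base imageI) blast
    qed blast
    have "part_space Q \<subseteq> span ?B" unfolding part_space_eq_span[OF Q(1)]
    proof (rule span_minimal[OF _ subspace_span])
      have "ind_vec P \<in> span ?B" if "P \<in> Q" for P
        using bV[of "Inl P"] that V by (simp add: b_def)
      then show "ind_vec ` Q \<subseteq> span ?B" by blast
    qed
    moreover have "part_space Q' \<subseteq> span ?B" unfolding part_space_eq_span[OF Q(2)]
    proof (rule span_minimal[OF _ subspace_span])
      have "ind_vec P \<in> span ?B" if "P \<in> Q'" for P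
        using bV[of "Inr P"] that span_neg[of "- ind_vec P" ?B] V by (simp add: b_def)
      then show "ind_vec ` Q' \<subseteq> span ?B" by blast
    qed
    ultimately have "set_add (part_space Q) (part_space Q') \<subseteq> span ?B"
      unfolding set_add_def by (auto intro!: span_add)
    then have "CARD('m) \<le> card ?B"
      using dim_le_card[of UNIV ?B] fin U by simp
    also have "\<dots> \<le> card (?V - {u, v})" using fin by (simp add: card_image_le)
    also have "\<dots> = card ?V - 2"
    proof -
      have "u \<noteq> v" using T by blast
      then show ?thesis using u v by (simp add: card_Diff_subset)
    qed
    also have "card ?V = card Q + card Q'"
      unfolding V by (subst card_Un_disjoint) (auto simp: card_image)
    finally have le: "CARD('m) \<le> card Q + card Q' - 2" .
    \<comment> \<open>Subtraction of 2 is truncated in \<open>le\<close>; positivity excludes the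
      case of fewer than two parts in total.\<close>
    have "CARD('m) > 0" by simp
    then show False using le card by linarith
  qed
qed

text \<open>By \<open>part_graph_acyclic_axis\<close> every unit vector is a sum of integral vectors
  of the two spaces. By linearity so is every integral vector, hence the two lattices add up to the
  full integer lattice.\<close>

lemma part_graph_tree_lattice:
  fixes Q Q' :: "'m::finite set set"
  assumes acyc: "\<nexists>vs es. is_cycle (part_graph Q Q') vs es"
  shows "set_add (part_space Q) (part_space Q') = UNIV"
    and "lattice_index (set_add (lattice_of (part_space Q)) (lattice_of (part_space Q'))) = 1"
proof -
  have "\<exists>c d :: 'm set \<Rightarrow> real. range c \<subseteq> \<int> \<and> range d \<subseteq> \<int> \<and>
      axis i 1 = (\<chi> k. c (part_of Q k)) + (\<chi> k. d (part_of Q' k))" for i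
    using part_graph_acyclic_axis[OF acyc] by metis
  then obtain c d :: "'m \<Rightarrow> 'm set \<Rightarrow> real" where cd: "\<And>i. range (c i) \<subseteq> \<int>" "\<And>i. range (d i) \<subseteq> \<int>"
      "\<And>i. axis i 1 = (\<chi> k. c i (part_of Q k)) + (\<chi> k. d i (part_of Q' k))"
    by metis
  define C where "C x P = (\<Sum>i\<in>UNIV. x $ i * c i P)" for x :: "real^'m" and P
  define D where "D x P = (\<Sum>i\<in>UNIV. x $ i * d i P)" for x :: "real^'m" and P
  have decomp: "x = (\<chi> k. C x (part_of Q k)) + (\<chi> k. D x (part_of Q' k))" for x
  proof -
    have "x $ k = C x (part_of Q k) + D x (part_of Q' k)" for k
    proof -
      have "C x (part_of Q k) + D x (part_of Q' k) =
          (\<Sum>i\<in>UNIV. x $ i * ((\<chi> k. c i (part_of Q k)) + (\<chi> k. d i (part_of Q' k))) $ k)"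
        by (simp add: C_def D_def sum.distrib algebra_simps)
      also have "\<dots> = (\<Sum>i\<in>UNIV. x $ i * axis i 1 $ k)" by (simp only: cd(3))
      also have "\<dots> = (\<Sum>i\<in>UNIV. if i = k then x $ i else 0)"
        by (intro sum.cong) (auto simp: axis_def)
      also have "\<dots> = x $ k" by simp
      finally show ?thesis by simp
    qed
    then show ?thesis by (simp add: vec_eq_iff)
  qed
  show "set_add (part_space Q) (part_space Q') = UNIV"
  proof (intro equalityI subsetI UNIV_I)
    fix x :: "real^'m"
    show "x \<in> set_add (part_space Q) (part_space Q')"
      unfolding set_add_def using decomp[of x] part_spaceI by blast
  qed
  have sub: "int_lattice \<inter> part_space R \<subseteq> lattice_of (part_space R)" for R :: "'m set set"
  proof -
    have "x \<in> direction_space (part_space R)" if "x \<in> part_space R" for x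
      unfolding direction_space_def
      using that subspace_0[OF subspace_part_space, of R] diff_zero[of x] by (intro span_base) force
    then show ?thesis unfolding lattice_of_def by blast
  qed
  have int: "x \<in> set_add (lattice_of (part_space Q)) (lattice_of (part_space Q'))" if x: "x \<in> int_lattice" for x
  proof -
    have "c i P \<in> \<int>" "d i P \<in> \<int>" for i P using cd(1,2)[of i] by blast+
    then have "C x P \<in> \<int>" "D x P \<in> \<int>" for P
      unfolding C_def D_def using x by (auto simp: int_lattice_def)
    then have "(\<chi> k. C x (part_of Q k)) \<in> lattice_of (part_space Q)"
      "(\<chi> k. D x (part_of Q' k)) \<in> lattice_of (part_space Q')"
      by (auto intro!: subsetD[OF sub] simp: int_lattice_def part_spaceI)
    then show ?thesis unfolding set_add_def using decomp[of x] by blast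
  qed
  have diff: "x - y \<in> int_lattice" if "x \<in> int_lattice" "y \<in> int_lattice" for x y :: "real^'m"
    using that by (auto simp: int_lattice_def)
  \<comment> \<open>All integral vectors are now equivalent, so the quotient has a single
    class.\<close>
  have "{(x, y). x \<in> int_lattice \<and> y \<in> int_lattice \<and>
      x - y \<in> set_add (lattice_of (part_space Q)) (lattice_of (part_space Q'))} =
      (int_lattice :: (real^'m) set) \<times> int_lattice"
    using int diff by auto
  moreover have "(0 :: real^'m) \<in> int_lattice" by (simp add: int_lattice_def)
  then have "int_lattice // ((int_lattice :: (real^'m) set) \<times> int_lattice) = {int_lattice}"
    unfolding quotient_def by blast
  ultimately show "lattice_index (set_add (lattice_of (part_space Q)) (lattice_of (part_space Q'))) = 1"
    unfolding lattice_index_def by simp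
qed

text \<open>Acyclicity gives both conditions on the right. Conversely, the spanning condition
  excludes cycles and, by the count of indicator vectors, forces connectedness.\<close>

lemma part_graph_is_tree_iff:
  fixes Q Q' :: "'m::finite set set"
  assumes "is_partition Q" "is_partition Q'" "card Q + card Q' \<le> Suc CARD('m)"
  shows "is_tree (part_graph Q Q') \<longleftrightarrow> set_add (part_space Q) (part_space Q') = UNIV \<and>
    lattice_index (set_add (lattice_of (part_space Q)) (lattice_of (part_space Q'))) = 1"
  unfolding is_tree_def
  using part_graph_tree_lattice part_graph_connected[OF assms] part_graph_cycle_span by metis

section \<open>Tropicalization and the pairing\<close>

lemma flat_chain_multiedge_iff:
  assumes "P \<noteq> {}" "finite P" "card S = 2" "\<And>e. e \<in> P \<Longrightarrow> ends H e = S"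
  defines "C \<equiv> H\<lparr>verts := S, edges := P\<rparr>"
  shows "flat_chain C Fs \<longleftrightarrow> Fs = [{}]"
proof -
  have wf: "wf_multigraph C"
    using assms by (auto simp: wf_multigraph_def intro: card_ge_0_finite)
  obtain u v where S: "S = {u, v}" using assms(3) by (auto simp: card_2_iff)
  \<comment> \<open>A nonempty flat contains an edge and so connects the two vertices; closure then
    adds all the parallel edges.\<close>
  have flat: "F = {}" if F: "is_flat C F" "F \<noteq> P" for F
  proof (rule ccontr)
    assume "F \<noteq> {}"
    then obtain e where e: "e \<in> F" by blast
    have FP: "F \<subseteq> P" using F by (simp add: is_flat_def C_def)
    then have "ends C e = {u, v}" using e assms(4) S by (auto simp: C_def)
    then have "(u, v) \<in> conn C F" by (rule conn_edge[OF e])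
    moreover have "\<forall>f\<in>edges C. \<forall>u v. ends C f = {u, v} \<longrightarrow> (u, v) \<in> conn C F \<longrightarrow> f \<in> F"
      using F(1) unfolding is_flat_iff[OF wf] by (rule conjunct2)
    moreover have "f \<in> edges C \<and> ends C f = {u, v}" if "f \<in> P" for f
      using assms(4)[OF that] that S by (simp add: C_def)
    ultimately have "P \<subseteq> F" by blast
    then show False using FP F(2) by simp
  qed
  show ?thesis
  proof
    assume chain: "flat_chain C Fs"
    then obtain xs where xs: "Fs = {} # xs" by (cases Fs) (auto simp: flat_chain_def)
    have "xs = []"
    proof (rule ccontr)
      assume "xs \<noteq> []"
      then obtain F where "F \<in> set xs" by (cases xs) auto
      then have "{} \<subset> F" "is_flat C F" "F \<noteq> P" using chain xs by (auto simp: flat_chain_def C_def)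
      then show False using flat by blast
    qed
    then show "Fs = [{}]" using xs by simp
  next
    assume "Fs = [{}]"
    then show "flat_chain C Fs" using is_flat_empty[OF wf] assms(1) by (simp add: flat_chain_def C_def)
  qed
qed

text \<open>The empty flat has the zero vector as its indicator, so its ray disappears and just the
  lineality line is left.\<close>

lemma chain_cone_trivial:
  fixes H :: "('v, 'm::finite) multigraph"
  shows "chain_cone H [{}] = range (\<lambda>t. t *\<^sub>R ind_vec (edges H))"
proof -
  have "ind_vec {} = (0 :: real^'m)" by (simp add: vec_eq_iff ind_vec_def)
  then show ?thesis unfolding chain_cone_def by (auto intro: exI[of _ "\<lambda>_. 0"])
qed

lemma multiedge_union_partition:
  assumes "multiedge_union H Q g" "edges H = UNIV"
  shows "is_partition Q"
  unfolding is_partition_def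
proof (intro conjI ballI impI)
  show "\<Union>Q = UNIV" using assms by (simp add: multiedge_union_def)
  fix P P' assume "P \<in> Q" "P' \<in> Q" "P \<inter> P' \<noteq> {}"
  then show "P = P'" using multiedge_union_disjoint[OF assms(1)] by blast
qed

text \<open>By \<open>flat_chain_multiedge_iff\<close> and \<open>chain_cone_trivial\<close> each
  component contributes only the line through the indicator of its part. The product of these lines
  is a single linear cell.\<close>

lemma trop_multiedge_union:
  fixes H :: "('v, 'm::finite) multigraph"
  assumes mu: "multiedge_union H Q g" and E: "edges H = UNIV"
  shows "trop H = \<lparr>cells = {part_space Q}, mult = (\<lambda>_. 1)\<rparr>"
proof -
  have Q: "is_partition Q" by (rule multiedge_union_partition[OF mu E])
  define comp where "comp P = H\<lparr>verts := g P, edges := P\<rparr>" for P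
  have K: "{C \<in> components_of H. edges C \<noteq> {}} = comp ` Q"
    unfolding multiedge_union_components[OF mu] comp_def using mu by (auto simp: multiedge_union_def)
  \<comment> \<open>A component is recovered from its edge set, so sums over components become sums
    over parts.\<close>
  have inj: "inj_on comp Q"
  proof (rule inj_onI)
    fix P P' assume "comp P = comp P'"
    then have "edges (comp P) = edges (comp P')" by simp
    then show "P = P'" by (simp add: comp_def)
  qed
  have cones: "connected_trop_cones (comp P) = {range (\<lambda>t. t *\<^sub>R ind_vec P)}" if P: "P \<in> Q" for P
  proof -
    have "P \<noteq> {}" "card (g P) = 2" "\<And>e. e \<in> P \<Longrightarrow> ends H e = g P"
      using mu P by (auto simp: multiedge_union_def)
    then have "{Fs. flat_chain (comp P) Fs} = {[{}]}"
      unfolding comp_def using flat_chain_multiedge_iff[of P "g P" H] by auto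
    then show ?thesis unfolding connected_trop_cones_def by (simp add: chain_cone_trivial comp_def)
  qed
  have sum: "{\<Sum>C\<in>comp ` Q. y C | y. \<forall>C\<in>comp ` Q. y C \<in> \<sigma> C} = part_space Q"
    if \<sigma>: "\<forall>C\<in>comp ` Q. \<sigma> C \<in> connected_trop_cones C" for \<sigma>
  proof -
    have \<sigma>P: "\<sigma> (comp P) = range (\<lambda>t. t *\<^sub>R ind_vec P)" if "P \<in> Q" for P
      using \<sigma> cones[OF that] that by auto
    show ?thesis
    proof (intro equalityI subsetI)
      fix x assume "x \<in> {\<Sum>C\<in>comp ` Q. y C | y. \<forall>C\<in>comp ` Q. y C \<in> \<sigma> C}"
      then obtain y where y: "x = (\<Sum>C\<in>comp ` Q. y C)" "\<forall>P\<in>Q. y (comp P) \<in> \<sigma> (comp P)" by blast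
      then have "\<forall>P\<in>Q. \<exists>t. y (comp P) = t *\<^sub>R ind_vec P" using \<sigma>P by auto
      then obtain t where "\<forall>P\<in>Q. y (comp P) = t P *\<^sub>R ind_vec P" by metis
      then have "x = (\<Sum>P\<in>Q. t P *\<^sub>R ind_vec P)" using y(1) by (simp add: sum.reindex[OF inj])
      then show "x \<in> part_space Q" using part_space_sum[OF Q, of t] part_spaceI[of t Q] by simp
    next
      fix x assume "x \<in> part_space Q"
      then obtain t where t: "x = (\<Sum>P\<in>Q. t P *\<^sub>R ind_vec P)"
        unfolding part_space_def part_space_sum[OF Q] by blast
      define y where "y C = t (edges C) *\<^sub>R (ind_vec (edges C) :: real^'m)" for C :: "('v, 'm) multigraph"
      have "x = (\<Sum>C\<in>comp ` Q. y C)"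
        unfolding t sum.reindex[OF inj] by (simp add: y_def comp_def)
      moreover have "\<forall>C\<in>comp ` Q. y C \<in> \<sigma> C" using \<sigma>P by (auto simp: y_def comp_def)
      ultimately show "x \<in> {\<Sum>C\<in>comp ` Q. y C | y. \<forall>C\<in>comp ` Q. y C \<in> \<sigma> C}" by blast
    qed
  qed
  have ex: "\<forall>C\<in>comp ` Q. range (\<lambda>t. t *\<^sub>R ind_vec (edges C)) \<in> connected_trop_cones C"
    using cones by (auto simp: comp_def)
  have "{{\<Sum>C\<in>comp ` Q. y C | y. \<forall>C\<in>comp ` Q. y C \<in> \<sigma> C} | \<sigma>.
      \<forall>C\<in>comp ` Q. \<sigma> C \<in> connected_trop_cones C} = {part_space Q}" (is "?S = _")
  proof (intro equalityI subsetI)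
    fix X assume "X \<in> ?S"
    then obtain \<sigma> where "X = {\<Sum>C\<in>comp ` Q. y C | y. \<forall>C\<in>comp ` Q. y C \<in> \<sigma> C}"
      "\<forall>C\<in>comp ` Q. \<sigma> C \<in> connected_trop_cones C" by blast
    then show "X \<in> {part_space Q}" using sum[of \<sigma>] by simp
  next
    fix X assume "X \<in> {part_space Q}"
    then have "X = {\<Sum>C\<in>comp ` Q. y C | y. \<forall>C\<in>comp ` Q. y C \<in> range (\<lambda>t. t *\<^sub>R ind_vec (edges C))}"
      using sum[OF ex] by simp
    then show "X \<in> ?S" unfolding mem_Collect_eq
      by (intro exI[of _ "\<lambda>C. range (\<lambda>t. t *\<^sub>R ind_vec (edges C))"] conjI ex)
  qed
  then show ?thesis unfolding trop_def Let_def K by simp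
qed

text \<open>For single linear spaces negation changes nothing, and if \<open>L\<close> and
  \<open>L'\<close> together span everything, then \<open>L\<close> meets every translate of
  \<open>L'\<close>. The only pair of cells then contributes for every direction \<open>u\<close>,
  so the value does not depend on the vector picked by \<open>SOME\<close>.\<close>

lemma galactic_pairing_linear:
  fixes H :: "('v, 'm::finite) multigraph"
  assumes H: "trop H = \<lparr>cells = {L}, mult = (\<lambda>_. 1)\<rparr>" and H': "trop H' = \<lparr>cells = {L'}, mult = (\<lambda>_. 1)\<rparr>"
    and L: "subspace L" "span {ind_vec UNIV} \<subseteq> L" and L': "subspace L'" "span {ind_vec UNIV} \<subseteq> L'"
  shows "galactic_pairing H H' =
    (if set_add L L' = UNIV then lattice_index (set_add (lattice_of L) (lattice_of L')) else 0)"
proof -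
  let ?S = "\<lparr>cells = {L}, mult = (\<lambda>_. 1)\<rparr>" and ?S' = "\<lparr>cells = {L'}, mult = (\<lambda>_. 1)\<rparr>"
  have "uminus ` L' = L'"
  proof (intro equalityI subsetI)
    fix x assume "x \<in> L'"
    then have "- x \<in> L'" using subspace_neg[OF L'(1)] by simp
    then show "x \<in> uminus ` L'" by (metis image_eqI minus_minus)
  qed (use subspace_neg[OF L'(1)] in auto)
  then have neg: "neg_complex ?S' = ?S'" by (simp add: neg_complex_def)
  have "subspace (set_add L L')" unfolding set_add_def using subspace_sums[OF L(1) L'(1)] .
  \<comment> \<open>A subspace is its own affine hull, so full affine dimension means that it is the
    whole space.\<close>
  then have "affine hull (set_add L L') = set_add L L'"
    by (simp add: subspace_imp_affine affine_hull_eq)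
  then have full: "aff_dim (set_add L L') = int CARD('m) \<longleftrightarrow> set_add L L' = UNIV"
    using aff_dim_eq_full[of "set_add L L'"] by (simp only: DIM_cart DIM_real mult_1_right)
  have cells: "stable_cells ?S ?S' = {} \<longleftrightarrow> set_add L L' \<noteq> UNIV"
    unfolding stable_cells_def full[symmetric] by auto
  have "stable_mult ?S ?S' (span {ind_vec UNIV}) = lattice_index (set_add (lattice_of L) (lattice_of L'))"
    if U: "set_add L L' = UNIV"
  proof -
    have "L \<inter> (\<lambda>x. x + \<epsilon> *\<^sub>R u) ` L' \<noteq> {}" for \<epsilon> and u :: "real^'m"
    proof -
      obtain x y where xy: "\<epsilon> *\<^sub>R u = x + y" "x \<in> L" "y \<in> L'"
        using U unfolding set_add_def by blast
      then have "x = - y + \<epsilon> *\<^sub>R u" by simp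
      moreover have "- y \<in> L'" using subspace_neg[OF L'(1) xy(3)] .
      ultimately show ?thesis using xy(2) by blast
    qed
    then have "{(\<tau>\<^sub>1, \<tau>\<^sub>2). \<tau>\<^sub>1 \<in> maximal_cells ?S \<and> \<tau>\<^sub>2 \<in> maximal_cells ?S' \<and>
        span {ind_vec UNIV} \<subseteq> \<tau>\<^sub>1 \<and> span {ind_vec UNIV} \<subseteq> \<tau>\<^sub>2 \<and>
        (\<forall>\<^sub>F \<epsilon> in at_right 0. \<tau>\<^sub>1 \<inter> (\<lambda>x. x + \<epsilon> *\<^sub>R u) ` \<tau>\<^sub>2 \<noteq> {})} = {(L, L')}" for u :: "real^'m"
      using L(2) L'(2) by (auto simp: maximal_cells_def)
    then show ?thesis unfolding stable_mult_def displaced_mult_def by simp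
  qed
  then show ?thesis unfolding galactic_pairing_def H H' neg cells by simp
qed

theorem proposition6p3:
  fixes G :: "('v::infinite, 'm::finite) multigraph"
    and Fs Fs' :: "'m set list"
  assumes "laman G"
    and "edges G = UNIV"
    and "maximal_flat_chain G Fs"
    and "maximal_flat_chain G Fs'"
  defines "\<F> \<equiv> chain_excision G Fs"
    and "\<F>' \<equiv> chain_excision G Fs'"
  shows "\<F> \<in> gamma_vertices G \<and> fully_excised \<F> \<and>
         \<F>' \<in> gamma_vertices G \<and> fully_excised \<F>' \<and>
         (arboreal_pair G Fs Fs' \<longleftrightarrow> galactic_pairing \<F> \<F>' = 1)"
proof -
  have wf: "wf_multigraph G" using assms(1) by (simp add: laman_def simple_graph_def)
  note con = laman_connected[OF assms(1)]
  let ?Q = "set (reduced_flats G Fs)" and ?Q' = "set (reduced_flats G Fs')"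
  obtain g where g: "\<F> \<in> gamma_vertices G" "multiedge_union \<F> ?Q g"
    "Suc (length (reduced_flats G Fs)) = card (verts G)"
    using chain_excision_structure[OF wf con assms(3)] unfolding \<F>_def by blast
  obtain g' where g': "\<F>' \<in> gamma_vertices G" "multiedge_union \<F>' ?Q' g'"
    "Suc (length (reduced_flats G Fs')) = card (verts G)"
    using chain_excision_structure[OF wf con assms(4)] unfolding \<F>'_def by blast
  have edges_gamma: "edges H = UNIV" if "H \<in> gamma_vertices G" for H
    using that by induction (simp_all add: assms(2) excise_def Let_def)
  note E = edges_gamma[OF g(1)] and E' = edges_gamma[OF g'(1)]
  have "int CARD('m) = 2 * int (card (verts G)) - 3"
    using assms(1,2) by (simp add: laman_def)
  \<comment> \<open>Each list has n - 1 entries and the Laman count gives m = 2n - 3, so the two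
    lengths add up to m + 1. Passing from lists to sets can only lower the count.\<close>
  then have card: "card ?Q + card ?Q' \<le> Suc CARD('m)"
    using card_length[of "reduced_flats G Fs"] card_length[of "reduced_flats G Fs'"] g(3) g'(3) by linarith
  \<comment> \<open>\<open>part_of\<close> uses the same description operator as
    \<open>intersection_graph\<close>, so the two graphs agree by unfolding.\<close>
  have "intersection_graph G Fs Fs' = part_graph ?Q ?Q'"
    unfolding intersection_graph_def part_graph_def part_of_def assms(2) ..
  then have "arboreal_pair G Fs Fs' \<longleftrightarrow> is_tree (part_graph ?Q ?Q')"
    by (simp add: arboreal_pair_def)
  also have "\<dots> \<longleftrightarrow> galactic_pairing \<F> \<F>' = 1"
    unfolding part_graph_is_tree_iff[OF multiedge_union_partition[OF g(2) E]
        multiedge_union_partition[OF g'(2) E'] card]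
      galactic_pairing_linear[OF trop_multiedge_union[OF g(2) E] trop_multiedge_union[OF g'(2) E']
        subspace_part_space span_ones_subset_part_space subspace_part_space span_ones_subset_part_space]
    by simp
  finally show ?thesis
    using g(1) g'(1) multiedge_union_fully_excised[OF g(2)] multiedge_union_fully_excised[OF g'(2)] by simp
qed

end
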